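(* Let $H\subseteq G$ be an inclusion of discrete groups with $H$ abelian, and suppose that for each $g\in G\setminus H$ the set $\{hgh^{-1}:h\in H\}$ is infinite, so that $L(H)$ is a masa (maximal abelian von Neumann subalgebra) in $L(G)$. Then $$\mathcal{N}_{L(G)}(L(H))''=L(\mathcal{N}_G(H)).$$ In particular, $L(H)$ is a singular masa if and only if $\mathcal{N}_G(H)=H$, and $L(H)$ is Cartan precisely when $H$ is a normal subgroup of $G$.
   Context: $L(G)$ is the (left) group von Neumann algebra of the discrete group $G$, and for a subgroup $K\subseteq G$, $L(K)$ is regarded as the von Neumann subalgebra of $L(G)$ generated by the group unitaries of $K$. $G$ is not assumed to be I.C.C. $\mathcal{N}_G(H)=\{g\in G: gHg^{-1}=H\}$. For a von Neumann subalgebra $B\subseteq M$, $\mathcal{N}_M(B)$ is the group of unitaries $u\in M$ with $uBu^*=B$, and $\mathcal{N}_M(B)''$ is the von Neumann algebra it generates. A masa $B$ in $M$ is singular if $\mathcal{N}_M(B)''=B$, and Cartan if $\mathcal{N}_M(B)''=M$. *)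

theory Defs
  imports "HOL-Analysis.Infinite_Sum" "HOL-Algebra.Group_Action" "HOL-Library.FuncSet"
begin

section \<open>Bounded operators on the Hilbert space of square-summable functions\<close>

text \<open>
  The Hilbert space over an arbitrary (possibly uncountable) index set \<open>S\<close> consists of the
  square-summable complex functions on \<open>S\<close>, represented as functions on the whole type that
  vanish off \<open>S\<close>.
\<close>

definition l2 :: "'a set \<Rightarrow> ('a \<Rightarrow> complex) set" where
  "l2 S = {f. (\<forall>x. x \<notin> S \<longrightarrow> f x = 0) \<and> (\<lambda>x. (cmod (f x))\<^sup>2) summable_on S}"

definition l2_inner :: "'a set \<Rightarrow> ('a \<Rightarrow> complex) \<Rightarrow> ('a \<Rightarrow> complex) \<Rightarrow> complex" where
  "l2_inner S f g = (\<Sum>\<^sub>\<infinity>x\<in>S. f x * cnj (g x))"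

definition l2_norm :: "'a set \<Rightarrow> ('a \<Rightarrow> complex) \<Rightarrow> real" where
  "l2_norm S f = sqrt (\<Sum>\<^sub>\<infinity>x\<in>S. (cmod (f x))\<^sup>2)"

text \<open>
  Operators are extensional functions (\<open>undefined\<close> off \<^term>\<open>l2 S\<close>), so that equality of
  operators is equality in HOL, their product is \<^term>\<open>compose (l2 S)\<close>, and the identity
  operator is \<^term>\<open>restrict id (l2 S)\<close>.
\<close>

type_synonym 'a l2_op = "('a \<Rightarrow> complex) \<Rightarrow> ('a \<Rightarrow> complex)"

definition bounded_ops :: "'a set \<Rightarrow> 'a l2_op set" where
  "bounded_ops S =
    {T \<in> l2 S \<rightarrow>\<^sub>E l2 S.
       (\<forall>f\<in>l2 S. \<forall>g\<in>l2 S. T (\<lambda>x. f x + g x) = (\<lambda>x. T f x + T g x)) \<and>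
       (\<forall>c. \<forall>f\<in>l2 S. T (\<lambda>x. c * f x) = (\<lambda>x. c * T f x)) \<and>
       (\<exists>C. \<forall>f\<in>l2 S. l2_norm S (T f) \<le> C * l2_norm S f)}"

definition adj_op :: "'a set \<Rightarrow> 'a l2_op \<Rightarrow> 'a l2_op" where
  "adj_op S T =
    (THE T'. T' \<in> bounded_ops S \<and>
       (\<forall>f\<in>l2 S. \<forall>g\<in>l2 S. l2_inner S (T f) g = l2_inner S f (T' g)))"

definition unitary_op :: "'a set \<Rightarrow> 'a l2_op \<Rightarrow> bool" where
  "unitary_op S U \<longleftrightarrow> U \<in> bounded_ops S \<and>
     compose (l2 S) (adj_op S U) U = restrict id (l2 S) \<and>
     compose (l2 S) U (adj_op S U) = restrict id (l2 S)"


section \<open>Von Neumann algebras\<close>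

definition commutant :: "'a set \<Rightarrow> 'a l2_op set \<Rightarrow> 'a l2_op set" where
  "commutant S X =
    {T \<in> bounded_ops S. \<forall>U\<in>X. compose (l2 S) T U = compose (l2 S) U T}"

text \<open>
  For a set \<open>X\<close> of bounded operators closed under adjoints, in particular for a group of
  unitaries, the double commutant \<open>X''\<close> is the von Neumann algebra generated by \<open>X\<close>.
  Below, generated algebras are formed only from groups of unitaries.
\<close>

definition bicommutant :: "'a set \<Rightarrow> 'a l2_op set \<Rightarrow> 'a l2_op set" where
  "bicommutant S X = commutant S (commutant S X)"

text \<open>
  A set of operators equal to its double commutant is automatically a unital subalgebra. So all
  von Neumann algebras here contain the identity operator.
\<close>

definition von_neumann_algebra :: "'a set \<Rightarrow> 'a l2_op set \<Rightarrow> bool" where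
  "von_neumann_algebra S M \<longleftrightarrow>
     M \<subseteq> bounded_ops S \<and> (\<forall>T\<in>M. adj_op S T \<in> M) \<and> bicommutant S M = M"

definition abelian_ops :: "'a set \<Rightarrow> 'a l2_op set \<Rightarrow> bool" where
  "abelian_ops S M \<longleftrightarrow> (\<forall>T\<in>M. \<forall>U\<in>M. compose (l2 S) T U = compose (l2 S) U T)"

definition masa :: "'a set \<Rightarrow> 'a l2_op set \<Rightarrow> 'a l2_op set \<Rightarrow> bool" where
  "masa S B M \<longleftrightarrow>
     von_neumann_algebra S B \<and> B \<subseteq> M \<and> abelian_ops S B \<and>
     (\<forall>A. von_neumann_algebra S A \<and> abelian_ops S A \<and> B \<subseteq> A \<and> A \<subseteq> M \<longrightarrow> A = B)"

definition unitary_normalizer :: "'a set \<Rightarrow> 'a l2_op set \<Rightarrow> 'a l2_op set \<Rightarrow> 'a l2_op set" where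
  "unitary_normalizer S M B =
    {U \<in> M. unitary_op S U \<and>
       (\<lambda>T. compose (l2 S) U (compose (l2 S) T (adj_op S U))) ` B = B}"

definition singular_masa :: "'a set \<Rightarrow> 'a l2_op set \<Rightarrow> 'a l2_op set \<Rightarrow> bool" where
  "singular_masa S B M \<longleftrightarrow> masa S B M \<and> bicommutant S (unitary_normalizer S M B) = B"

definition cartan_masa :: "'a set \<Rightarrow> 'a l2_op set \<Rightarrow> 'a l2_op set \<Rightarrow> bool" where
  "cartan_masa S B M \<longleftrightarrow> masa S B M \<and> bicommutant S (unitary_normalizer S M B) = M"


section \<open>Group von Neumann algebras\<close>

definition left_regular :: "('a, 'b) monoid_scheme \<Rightarrow> 'a \<Rightarrow> 'a l2_op" where
  "left_regular G g =
    (\<lambda>f\<in>l2 (carrier G). \<lambda>x. if x \<in> carrier G then f (inv\<^bsub>G\<^esub> g \<otimes>\<^bsub>G\<^esub> x) else 0)"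

text \<open>
  \<open>group_vna G K\<close> is \<open>L(K)\<close> regarded as a subalgebra of \<open>L(G)\<close>: it acts on the Hilbert space of
  the ambient group \<open>G\<close>. In particular \<open>L(G)\<close> itself is \<^term>\<open>group_vna G (carrier G)\<close>.
\<close>

definition group_vna :: "('a, 'b) monoid_scheme \<Rightarrow> 'a set \<Rightarrow> 'a l2_op set" where
  "group_vna G K = bicommutant (carrier G) (left_regular G ` K)"

end

theory Submission
  imports Defs "HOL-Analysis.L2_Norm"
begin

text \<open>
  An element \<open>T\<close> of \<open>L(G)\<close> is left convolution by its Fourier coefficients \<open>\<xi> = T \<delta>\<^sub>1\<close>, and it
  belongs to \<open>L(K)\<close> exactly when \<open>\<xi>\<close> is supported in the subgroup \<open>K\<close>
  (\<open>group_vnaI_support\<close>, \<open>group_vna_support\<close>). Everything is then a statement about supports.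

  If \<open>T\<close> commutes with \<open>\<lambda>(H)\<close>, then \<open>\<xi>\<close> is constant on the orbits of \<open>H\<close> acting by
  conjugation. The orbits outside \<open>H\<close> are infinite and \<open>\<xi>\<close> is square-summable, so \<open>\<xi>\<close> vanishes
  there and \<open>T \<in> L(H)\<close>. As \<open>H\<close> is abelian, \<open>L(H)\<close> is a masa.

  Let \<open>U\<close> be a unitary normalizing \<open>L(H)\<close>, with coefficients \<open>\<xi>\<close>. For \<open>h \<in> H\<close> the unitary
  \<open>V = U \<lambda>\<^sub>h U\<^sup>*\<close> of \<open>L(H)\<close> maps \<open>\<xi>\<close> to its right translate by \<open>h\<close> while preserving the norm on
  each right coset of \<open>H\<close>. So \<open>\<xi>\<close> has the same norm on all cosets \<open>H g a\<close> with \<open>a \<in> H\<close>, and if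
  \<open>\<xi>(g) \<noteq> 0\<close>, there are only finitely many of them (\<open>finite_cosets_in_support\<close>). For \<open>k \<in> H\<close>
  the \<open>H\<close>-orbit of \<open>g\<^sup>-\<^sup>1 k g\<close> is parametrized by these cosets. Hence it is finite, and the orbit
  hypothesis puts \<open>g\<^sup>-\<^sup>1 k g\<close> into \<open>H\<close> (\<open>conj_mem_if_finite_cosets\<close>). The same argument for \<open>U\<^sup>*\<close>
  and \<open>g\<^sup>-\<^sup>1\<close> shows that \<open>g\<close> normalizes \<open>H\<close>. Thus \<open>U \<in> L(N\<^sub>G(H))\<close>. Conversely, \<open>\<lambda>\<^sub>g\<close>
  normalizes \<open>L(H)\<close> for every \<open>g\<close> in the normalizer. The criteria for singular and Cartan masas
  follow because \<open>K\<close> can be recovered from \<open>L(K)\<close>.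
\<close>

section \<open>Square-summable functions\<close>

definition delta :: "'a \<Rightarrow> 'a \<Rightarrow> complex" where
  "delta x = (\<lambda>y. if y = x then 1 else 0)"

definition cutoff :: "'a set \<Rightarrow> ('a \<Rightarrow> complex) \<Rightarrow> 'a \<Rightarrow> complex" where
  "cutoff A f = (\<lambda>x. if x \<in> A then f x else 0)"

lemma delta_simps [simp]: "delta x x = 1" "y \<noteq> x \<Longrightarrow> delta x y = 0"
  by (simp_all add: delta_def)

lemma l2_outside: "f \<in> l2 S \<Longrightarrow> x \<notin> S \<Longrightarrow> f x = 0"
  by (simp add: l2_def)

lemma l2_summable: "f \<in> l2 S \<Longrightarrow> (\<lambda>x. (cmod (f x))\<^sup>2) summable_on S"
  by (simp add: l2_def)

lemma l2_eqI:
  assumes "f \<in> l2 S" "g \<in> l2 S" "\<And>x. x \<in> S \<Longrightarrow> f x = g x"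
  shows "f = g"
  using assms by (metis ext l2_outside)

lemma l2_dominated:
  assumes g: "g \<in> l2 S" and le: "\<And>x. cmod (f x) \<le> cmod (g x)"
  shows "f \<in> l2 S"
proof -
  have "(\<lambda>x. (cmod (f x))\<^sup>2) summable_on S"
    by (rule summable_on_comparison_test[OF l2_summable[OF g]])
       (auto intro: power_mono le)
  moreover have "f x = 0" if "x \<notin> S" for x
    using le[of x] l2_outside[OF g that] by simp
  ultimately show ?thesis by (simp add: l2_def)
qed

lemma l2_scale: "f \<in> l2 S \<Longrightarrow> (\<lambda>x. c * f x) \<in> l2 S"
  by (simp add: l2_def norm_mult power_mult_distrib summable_on_cmult_right)

lemma l2_add:
  assumes f: "f \<in> l2 S" and g: "g \<in> l2 S"
  shows "(\<lambda>x. f x + g x) \<in> l2 S"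
proof -
  have bound: "(cmod (f x + g x))\<^sup>2 \<le> 2 * (cmod (f x))\<^sup>2 + 2 * (cmod (g x))\<^sup>2" for x
  proof -
    have "(cmod (f x + g x))\<^sup>2 \<le> (cmod (f x) + cmod (g x))\<^sup>2"
      by (simp add: norm_triangle_ineq power_mono)
    also have "\<dots> \<le> 2 * (cmod (f x))\<^sup>2 + 2 * (cmod (g x))\<^sup>2"
      by (smt (verit) sum_squares_bound power2_sum)
    finally show ?thesis .
  qed
  have "(\<lambda>x. 2 * (cmod (f x))\<^sup>2 + 2 * (cmod (g x))\<^sup>2) summable_on S"
    by (intro summable_on_add summable_on_cmult_right l2_summable f g)
  then have "(\<lambda>x. (cmod (f x + g x))\<^sup>2) summable_on S"
    by (rule summable_on_comparison_test) (use bound in auto)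
  then show ?thesis
    using f g by (simp add: l2_def)
qed

lemma l2_cutoff: "f \<in> l2 S \<Longrightarrow> cutoff A f \<in> l2 S"
  by (rule l2_dominated[of f]) (auto simp: cutoff_def)

lemma l2_finite_support:
  assumes "finite F" "F \<subseteq> S" "\<And>x. x \<notin> F \<Longrightarrow> f x = 0"
  shows "f \<in> l2 S"
proof -
  have "(\<lambda>x. (cmod (f x))\<^sup>2) summable_on S \<longleftrightarrow> (\<lambda>x. (cmod (f x))\<^sup>2) summable_on F"
    by (rule summable_on_cong_neutral) (use assms in auto)
  then show ?thesis
    using assms by (auto simp: l2_def)
qed

lemma delta_in_l2: "x \<in> S \<Longrightarrow> delta x \<in> l2 S"
  by (rule l2_finite_support[of "{x}"]) (auto simp: delta_def)

lemma l2_norm_nonneg: "0 \<le> l2_norm S f"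
  by (simp add: l2_norm_def infsum_nonneg)

lemma l2_norm_sq: "(l2_norm S f)\<^sup>2 = (\<Sum>\<^sub>\<infinity>x\<in>S. (cmod (f x))\<^sup>2)"
  by (simp add: l2_norm_def infsum_nonneg)

lemma l2_norm_cutoff:
  assumes "A \<subseteq> S"
  shows "(l2_norm S (cutoff A f))\<^sup>2 = (\<Sum>\<^sub>\<infinity>x\<in>A. (cmod (f x))\<^sup>2)"
  unfolding l2_norm_sq by (rule infsum_cong_neutral) (use assms in \<open>auto simp: cutoff_def\<close>)

lemma L2_set_le_l2_norm:
  assumes "f \<in> l2 S" "finite F" "F \<subseteq> S"
  shows "L2_set (\<lambda>x. cmod (f x)) F \<le> l2_norm S f"
  unfolding L2_set_def l2_norm_def
  by (rule real_sqrt_le_mono, rule finite_sum_le_infsum) (use assms l2_summable in auto)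

lemma sum_mult_le_l2_norms:
  assumes "f \<in> l2 S" "g \<in> l2 S" "finite F" "F \<subseteq> S"
  shows "(\<Sum>x\<in>F. cmod (f x * g x)) \<le> l2_norm S f * l2_norm S g"
proof -
  have "(\<Sum>x\<in>F. cmod (f x * g x)) \<le> L2_set (\<lambda>x. cmod (f x)) F * L2_set (\<lambda>x. cmod (g x)) F"
    using L2_set_mult_ineq[of "\<lambda>x. cmod (f x)" "\<lambda>x. cmod (g x)" F] by (simp add: norm_mult)
  also have "\<dots> \<le> l2_norm S f * l2_norm S g"
    using assms by (intro mult_mono L2_set_le_l2_norm) (auto simp: l2_norm_nonneg)
  finally show ?thesis .
qed

lemma l2_cnj: "f \<in> l2 S \<Longrightarrow> (\<lambda>x. cnj (f x)) \<in> l2 S"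
  by (simp add: l2_def)

lemma l2_norm_cnj: "l2_norm S (\<lambda>x. cnj (f x)) = l2_norm S f"
  by (simp add: l2_norm_def)

lemma l2_mult_abs_summable:
  assumes f: "f \<in> l2 S" and g: "g \<in> l2 S"
  shows "(\<lambda>x. f x * g x) abs_summable_on S"
proof (rule nonneg_bdd_above_summable_on)
  show "bdd_above (sum (\<lambda>x. cmod (f x * g x)) ` {F. F \<subseteq> S \<and> finite F})"
    by (rule bdd_aboveI2[where M = "l2_norm S f * l2_norm S g"])
       (use sum_mult_le_l2_norms[OF f g] in auto)
qed simp

lemma l2_inner_summable:
  assumes "f \<in> l2 S" "g \<in> l2 S"
  shows "(\<lambda>x. f x * cnj (g x)) summable_on S"
  using l2_mult_abs_summable[OF assms(1) l2_cnj[OF assms(2)]] by (rule abs_summable_summable)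

lemma l2_Cauchy_Schwarz:
  assumes f: "f \<in> l2 S" and g: "g \<in> l2 S"
  shows "cmod (l2_inner S f g) \<le> l2_norm S f * l2_norm S g"
proof -
  have "cmod (l2_inner S f g) \<le> (\<Sum>\<^sub>\<infinity>x\<in>S. cmod (f x * cnj (g x)))"
    unfolding l2_inner_def
    by (rule norm_infsum_bound[OF l2_mult_abs_summable[OF f l2_cnj[OF g]]])
  also have "\<dots> \<le> l2_norm S f * l2_norm S g"
    using infsum_le_finite_sums[OF l2_mult_abs_summable[OF f l2_cnj[OF g]]]
      sum_mult_le_l2_norms[OF f l2_cnj[OF g]]
    by (simp add: l2_norm_cnj)
  finally show ?thesis .
qed

lemma l2_inner_add_left:
  assumes "f \<in> l2 S" "g \<in> l2 S" "h \<in> l2 S"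
  shows "l2_inner S (\<lambda>x. f x + g x) h = l2_inner S f h + l2_inner S g h"
  unfolding l2_inner_def distrib_right
  by (rule infsum_add) (use l2_inner_summable assms in auto)

lemma l2_inner_scale_left: "l2_inner S (\<lambda>x. c * f x) g = c * l2_inner S f g"
  by (simp add: l2_inner_def mult.assoc infsum_cmult_right')

lemma l2_inner_commute: "l2_inner S f g = cnj (l2_inner S g f)"
  unfolding l2_inner_def by (simp flip: infsum_cnj add: mult.commute)

lemma l2_inner_self:
  assumes "f \<in> l2 S"
  shows "l2_inner S f f = of_real ((l2_norm S f)\<^sup>2)"
proof -
  have "((\<lambda>x. complex_of_real ((cmod (f x))\<^sup>2)) has_sum of_real ((l2_norm S f)\<^sup>2)) S"
    unfolding l2_norm_sq
    by (rule has_sum_of_real[OF has_sum_infsum[OF l2_summable[OF assms]]])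
  then show ?thesis
    unfolding l2_inner_def complex_norm_square[symmetric] by (rule infsumI)
qed

lemma l2_inner_delta_right:
  assumes "x \<in> S"
  shows "l2_inner S f (delta x) = f x"
proof -
  have "l2_inner S f (delta x) = (\<Sum>\<^sub>\<infinity>y\<in>{x}. f y * cnj (delta x y))"
    unfolding l2_inner_def by (rule infsum_cong_neutral) (use assms in auto)
  then show ?thesis by simp
qed

lemma l2_coordinate_le_norm:
  assumes "f \<in> l2 S"
  shows "cmod (f x) \<le> l2_norm S f"
proof (cases "x \<in> S")
  case True
  then show ?thesis using L2_set_le_l2_norm[OF assms, of "{x}"] by simp
qed (simp add: l2_outside[OF assms] l2_norm_nonneg)

text \<open>
  Finitely supported functions are dense, so a bounded functional is determined by its values on
  the point masses. Applied to coordinate functionals this gives the matrix description of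
  bounded operators, and applied to \<open>\<langle>T f, g\<rangle>\<close> it gives the adjoint.
\<close>

lemma bounded_functional_has_sum:
  assumes add: "\<And>f g. f \<in> l2 S \<Longrightarrow> g \<in> l2 S \<Longrightarrow> \<phi> (\<lambda>x. f x + g x) = \<phi> f + \<phi> g"
    and scale: "\<And>c f. f \<in> l2 S \<Longrightarrow> \<phi> (\<lambda>x. c * f x) = c * \<phi> f"
    and bounded: "\<And>f. f \<in> l2 S \<Longrightarrow> cmod (\<phi> f) \<le> C * l2_norm S f"
    and f: "f \<in> l2 S"
  shows "((\<lambda>x. f x * \<phi> (delta x)) has_sum \<phi> f) S"
proof -
  let ?tail = "\<lambda>F. sqrt ((\<Sum>\<^sub>\<infinity>x\<in>S. (cmod (f x))\<^sup>2) - (\<Sum>x\<in>F. (cmod (f x))\<^sup>2))"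
  have zero: "\<phi> (\<lambda>_. 0) = 0"
    using scale[OF f, of 0] by simp
  have head: "\<phi> (cutoff F f) = (\<Sum>x\<in>F. f x * \<phi> (delta x))" if "finite F" "F \<subseteq> S" for F
    using that
  proof (induction F)
    case empty
    then show ?case by (simp add: cutoff_def zero)
  next
    case (insert x F)
    have "cutoff (insert x F) f = (\<lambda>y. f x * delta x y + cutoff F f y)"
      using insert.hyps by (auto simp: cutoff_def delta_def fun_eq_iff)
    then have "\<phi> (cutoff (insert x F) f) = f x * \<phi> (delta x) + \<phi> (cutoff F f)"
      using insert.prems by (simp add: add scale l2_scale delta_in_l2 l2_cutoff f)
    then show ?case
      using insert by simp
  qed
  have tail: "l2_norm S (cutoff (- F) f) = ?tail F" if "finite F" "F \<subseteq> S" for F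
  proof -
    have "(\<Sum>\<^sub>\<infinity>x\<in>S. (cmod (cutoff (- F) f x))\<^sup>2) = (\<Sum>\<^sub>\<infinity>x\<in>S - F. (cmod (f x))\<^sup>2)"
      by (rule infsum_cong_neutral) (auto simp: cutoff_def)
    also have "\<dots> = (\<Sum>\<^sub>\<infinity>x\<in>S. (cmod (f x))\<^sup>2) - (\<Sum>\<^sub>\<infinity>x\<in>F. (cmod (f x))\<^sup>2)"
      by (rule infsum_Diff) (use that l2_summable[OF f] in auto)
    finally show ?thesis
      using that by (simp add: l2_norm_def)
  qed
  have error: "cmod ((\<Sum>x\<in>F. f x * \<phi> (delta x)) - \<phi> f) \<le> C * ?tail F"
    if "finite F" "F \<subseteq> S" for F
  proof -
    have "f = (\<lambda>x. cutoff F f x + cutoff (- F) f x)"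
      by (auto simp: cutoff_def)
    then have "\<phi> f = \<phi> (cutoff F f) + \<phi> (cutoff (- F) f)"
      using add[OF l2_cutoff[OF f] l2_cutoff[OF f]] by metis
    then have "cmod ((\<Sum>x\<in>F. f x * \<phi> (delta x)) - \<phi> f) = cmod (\<phi> (cutoff (- F) f))"
      by (simp add: head[OF that])
    then show ?thesis
      using bounded[OF l2_cutoff[OF f, of "- F"]] by (simp add: tail[OF that])
  qed
  have "((\<lambda>F. \<Sum>x\<in>F. (cmod (f x))\<^sup>2) \<longlongrightarrow> (\<Sum>\<^sub>\<infinity>x\<in>S. (cmod (f x))\<^sup>2)) (finite_subsets_at_top S)"
    by (rule infsum_tendsto[OF l2_summable[OF f]])
  then have "((\<lambda>F. C * ?tail F)
      \<longlongrightarrow> C * sqrt ((\<Sum>\<^sub>\<infinity>x\<in>S. (cmod (f x))\<^sup>2) - (\<Sum>\<^sub>\<infinity>x\<in>S. (cmod (f x))\<^sup>2)))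
      (finite_subsets_at_top S)"
    by (intro tendsto_intros)
  then have "((\<lambda>F. C * ?tail F) \<longlongrightarrow> 0) (finite_subsets_at_top S)"
    by simp
  then have "((\<lambda>F. (\<Sum>x\<in>F. f x * \<phi> (delta x)) - \<phi> f) \<longlongrightarrow> 0) (finite_subsets_at_top S)"
    by (rule tendsto_0_le[where K = 1])
       (use error in \<open>fastforce intro!: eventually_finite_subsets_at_top_weakI
          intro: order_trans[OF _ abs_ge_self]\<close>)
  then show ?thesis
    unfolding has_sum_def by (simp add: LIM_zero_iff)
qed

text \<open>
  The squared norms of the pieces of \<open>f\<close> on disjoint sets add up to at most \<open>\<parallel>f\<parallel>\<^sup>2\<close>. This is
  the only source of finiteness below: it is applied to singletons of a conjugacy orbit and to
  right cosets.
\<close>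

lemma finite_family_of_equal_mass:
  assumes f: "f \<in> l2 S" and disj: "pairwise disjnt \<C>" and sub: "\<And>A. A \<in> \<C> \<Longrightarrow> A \<subseteq> S"
    and mass: "\<And>A. A \<in> \<C> \<Longrightarrow> l2_norm S (cutoff A f) = m" and "m > 0"
  shows "finite \<C>"
proof (rule ccontr)
  let ?q = "\<lambda>x. (cmod (f x))\<^sup>2"
  assume "infinite \<C>"
  obtain n where n: "of_nat n * m\<^sup>2 > (l2_norm S f)\<^sup>2"
    using \<open>m > 0\<close> reals_Archimedean3[of "m\<^sup>2"] by auto
  obtain \<F> where \<F>: "finite \<F>" "card \<F> = n" "\<F> \<subseteq> \<C>"
    using infinite_arbitrarily_large[OF \<open>infinite \<C>\<close>] by metis
  have q: "?q summable_on A" if "A \<subseteq> S" for A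
    by (rule summable_on_subset_banach[OF l2_summable[OF f] that])
  have piece: "infsum ?q A = m\<^sup>2" if "A \<in> \<C>" for A
    using l2_norm_cutoff[OF sub[OF that], of f] mass[OF that] by simp
  have "of_nat n * m\<^sup>2 = (\<Sum>A\<in>\<F>. infsum ?q A)"
    using \<F> piece by (simp add: subset_iff)
  also have "\<dots> = infsum ?q (\<Union>A\<in>\<F>. A)"
    by (rule sum_infsum)
       (use \<F> q sub disj in \<open>auto simp: pairwise_def disjnt_def subset_iff\<close>)
  also have "\<dots> \<le> infsum ?q S"
    using \<F> sub by (intro infsum_mono2 q) auto
  finally show False
    using n by (simp add: l2_norm_sq)
qed

section \<open>Bounded operators, adjoints and commutants\<close>

lemma bounded_opsI:
  assumes "\<And>f. f \<in> l2 S \<Longrightarrow> T f \<in> l2 S" "\<And>f. f \<notin> l2 S \<Longrightarrow> T f = undefined"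
    and "\<And>f g. f \<in> l2 S \<Longrightarrow> g \<in> l2 S \<Longrightarrow> T (\<lambda>x. f x + g x) = (\<lambda>x. T f x + T g x)"
    and "\<And>c f. f \<in> l2 S \<Longrightarrow> T (\<lambda>x. c * f x) = (\<lambda>x. c * T f x)"
    and "\<And>f. f \<in> l2 S \<Longrightarrow> l2_norm S (T f) \<le> C * l2_norm S f"
  shows "T \<in> bounded_ops S"
proof -
  have "\<exists>C. \<forall>f\<in>l2 S. l2_norm S (T f) \<le> C * l2_norm S f"
    using assms(5) by blast
  then show ?thesis
    unfolding bounded_ops_def using assms(1-4) by (simp add: PiE_def extensional_def)
qed

lemma
  assumes "T \<in> bounded_ops S"
  shows bounded_op_in_l2: "f \<in> l2 S \<Longrightarrow> T f \<in> l2 S"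
    and bounded_op_undefined: "f \<notin> l2 S \<Longrightarrow> T f = undefined"
    and bounded_op_add:
      "f \<in> l2 S \<Longrightarrow> g \<in> l2 S \<Longrightarrow> T (\<lambda>x. f x + g x) = (\<lambda>x. T f x + T g x)"
    and bounded_op_scale: "f \<in> l2 S \<Longrightarrow> T (\<lambda>x. c * f x) = (\<lambda>x. c * T f x)"
  using assms unfolding bounded_ops_def by (auto simp: PiE_def extensional_def)

lemma bounded_op_bound:
  assumes "T \<in> bounded_ops S"
  obtains C where "C \<ge> 0" "\<And>f. f \<in> l2 S \<Longrightarrow> l2_norm S (T f) \<le> C * l2_norm S f"
proof -
  obtain C where C: "\<And>f. f \<in> l2 S \<Longrightarrow> l2_norm S (T f) \<le> C * l2_norm S f"
    using assms unfolding bounded_ops_def by blast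
  have "l2_norm S (T f) \<le> \<bar>C\<bar> * l2_norm S f" if "f \<in> l2 S" for f
    using C[OF that] l2_norm_nonneg[of S f] by (meson abs_ge_self mult_right_mono order_trans)
  then show thesis by (rule that[of "\<bar>C\<bar>", rotated]) auto
qed

lemma bounded_op_eqI:
  assumes "T \<in> bounded_ops S" "U \<in> bounded_ops S" "\<And>f. f \<in> l2 S \<Longrightarrow> T f = U f"
  shows "T = U"
  using assms bounded_op_undefined by (metis ext)

lemma bounded_op_has_sum:
  assumes T: "T \<in> bounded_ops S" and f: "f \<in> l2 S"
  shows "((\<lambda>x. f x * T (delta x) y) has_sum T f y) S"
proof -
  obtain C where C: "\<And>f. f \<in> l2 S \<Longrightarrow> l2_norm S (T f) \<le> C * l2_norm S f"
    using bounded_op_bound[OF T] by metis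
  show ?thesis
  proof (rule bounded_functional_has_sum[where \<phi> = "\<lambda>f. T f y" and C = C])
    fix f assume f: "f \<in> l2 S"
    then show "cmod (T f y) \<le> C * l2_norm S f"
      using C[OF f] l2_coordinate_le_norm[OF bounded_op_in_l2[OF T f], of y] by linarith
  qed (use f in \<open>simp_all add: bounded_op_add[OF T] bounded_op_scale[OF T]\<close>)
qed

lemma bounded_op_eq_on_delta:
  assumes "T \<in> bounded_ops S" "U \<in> bounded_ops S"
    and "\<And>x. x \<in> S \<Longrightarrow> T (delta x) = U (delta x)"
  shows "T = U"
proof (rule bounded_op_eqI[OF assms(1,2)])
  fix f assume f: "f \<in> l2 S"
  show "T f = U f"
  proof
    fix y
    have "((\<lambda>x. f x * T (delta x) y) has_sum U f y) S"
      by (subst has_sum_cong[where g = "\<lambda>x. f x * U (delta x) y"])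
         (use assms bounded_op_has_sum[OF assms(2) f] in auto)
    then show "T f y = U f y"
      using bounded_op_has_sum[OF assms(1) f] has_sum_unique by blast
  qed
qed

lemma compose_bounded_ops:
  assumes T: "T \<in> bounded_ops S" and U: "U \<in> bounded_ops S"
  shows "compose (l2 S) T U \<in> bounded_ops S"
proof -
  obtain C where C: "C \<ge> 0" "\<And>f. f \<in> l2 S \<Longrightarrow> l2_norm S (T f) \<le> C * l2_norm S f"
    using bounded_op_bound[OF T] by metis
  obtain D where D: "\<And>f. f \<in> l2 S \<Longrightarrow> l2_norm S (U f) \<le> D * l2_norm S f"
    using bounded_op_bound[OF U] by metis
  show ?thesis
  proof (rule bounded_opsI[where C = "C * D"])
    fix f assume f: "f \<in> l2 S"
    have "l2_norm S (T (U f)) \<le> C * l2_norm S (U f)"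
      by (rule C(2)[OF bounded_op_in_l2[OF U f]])
    also have "\<dots> \<le> C * (D * l2_norm S f)"
      by (rule mult_left_mono[OF D[OF f] C(1)])
    finally show "l2_norm S (compose (l2 S) T U f) \<le> C * D * l2_norm S f"
      using f by (simp add: compose_def mult.assoc)
  qed (use bounded_op_in_l2[OF T] bounded_op_in_l2[OF U] in
      \<open>simp_all add: compose_def l2_add l2_scale bounded_op_add[OF T] bounded_op_add[OF U]
        bounded_op_scale[OF T] bounded_op_scale[OF U]\<close>)
qed

text \<open>
  The candidate \<open>(T\<^sup>* g)(x) = \<langle>g, T \<delta>\<^sub>x\<rangle>\<close> is forced. It is square-summable, with the bound
  required of the adjoint, because its finite truncations \<open>f\<close> satisfy
  \<open>\<parallel>f\<parallel>\<^sup>2 = \<langle>T f, g\<rangle> \<le> C \<parallel>f\<parallel> \<parallel>g\<parallel>\<close>.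
\<close>

lemma adjoint_exists:
  assumes T: "T \<in> bounded_ops S"
  shows "\<exists>T'\<in>bounded_ops S. \<forall>f\<in>l2 S. \<forall>g\<in>l2 S. l2_inner S (T f) g = l2_inner S f (T' g)"
proof -
  obtain C where C: "C \<ge> 0" "\<And>f. f \<in> l2 S \<Longrightarrow> l2_norm S (T f) \<le> C * l2_norm S f"
    using bounded_op_bound[OF T] by metis
  define T' where
    "T' = (\<lambda>g\<in>l2 S. \<lambda>x. if x \<in> S then l2_inner S g (T (delta x)) else 0)"
  have expand: "((\<lambda>x. f x * cnj (T' g x)) has_sum l2_inner S (T f) g) S"
    if f: "f \<in> l2 S" and g: "g \<in> l2 S" for f g
  proof -
    have "((\<lambda>x. f x * l2_inner S (T (delta x)) g) has_sum l2_inner S (T f) g) S"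
    proof (rule bounded_functional_has_sum[where \<phi> = "\<lambda>f. l2_inner S (T f) g"
          and C = "C * l2_norm S g", OF _ _ _ f])
      fix f assume f: "f \<in> l2 S"
      have "cmod (l2_inner S (T f) g) \<le> l2_norm S (T f) * l2_norm S g"
        by (rule l2_Cauchy_Schwarz[OF bounded_op_in_l2[OF T f] g])
      also have "\<dots> \<le> C * l2_norm S f * l2_norm S g"
        by (rule mult_right_mono[OF C(2)[OF f] l2_norm_nonneg])
      finally show "cmod (l2_inner S (T f) g) \<le> C * l2_norm S g * l2_norm S f"
        by (simp add: mult_ac)
    qed (simp_all add: bounded_op_add[OF T] bounded_op_scale[OF T] l2_inner_add_left
        l2_inner_scale_left bounded_op_in_l2[OF T] g)
    moreover have "cnj (T' g x) = l2_inner S (T (delta x)) g" if "x \<in> S" for x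
      using that g by (simp add: T'_def flip: l2_inner_commute)
    ultimately show ?thesis
      by (subst has_sum_cong) auto
  qed
  have truncation: "(\<Sum>x\<in>F. (cmod (T' g x))\<^sup>2) \<le> (C * l2_norm S g)\<^sup>2"
    if g: "g \<in> l2 S" and F: "finite F" "F \<subseteq> S" for g F
  proof -
    \<comment> \<open>The test vector at which pairing with \<open>g\<close> returns its own squared norm.\<close>
    define f where "f = cutoff F (T' g)"
    have f: "f \<in> l2 S"
      by (rule l2_finite_support[OF F]) (simp add: f_def cutoff_def)
    have "((\<lambda>x. f x * cnj (T' g x)) has_sum (\<Sum>x\<in>F. of_real ((cmod (T' g x))\<^sup>2))) S"
      by (rule has_sum_finite_neutralI[OF F])
         (auto simp: f_def cutoff_def complex_norm_square simp del: of_real_power)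
    then have inner: "l2_inner S (T f) g = of_real (\<Sum>x\<in>F. (cmod (T' g x))\<^sup>2)"
      using has_sum_unique[OF expand[OF f g]] by simp
    have norm: "(l2_norm S f)\<^sup>2 = (\<Sum>x\<in>F. (cmod (T' g x))\<^sup>2)"
      unfolding l2_norm_sq
      by (rule infsumI, rule has_sum_finite_neutralI[OF F]) (auto simp: f_def cutoff_def)
    have "(l2_norm S f)\<^sup>2 = cmod (l2_inner S (T f) g)"
      unfolding inner norm[symmetric] by (simp add: norm_power)
    also have "\<dots> \<le> l2_norm S (T f) * l2_norm S g"
      by (rule l2_Cauchy_Schwarz[OF bounded_op_in_l2[OF T f] g])
    also have "\<dots> \<le> C * l2_norm S f * l2_norm S g"
      by (rule mult_right_mono[OF C(2)[OF f] l2_norm_nonneg])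
    finally have "l2_norm S f * l2_norm S f \<le> l2_norm S f * (C * l2_norm S g)"
      by (simp add: power2_eq_square mult_ac)
    then have "l2_norm S f \<le> C * l2_norm S g"
      using l2_norm_nonneg[of S f] C(1) l2_norm_nonneg[of S g]
      by (cases "l2_norm S f = 0") auto
    then show ?thesis
      using power_mono[OF _ l2_norm_nonneg, of S f _ 2] norm by simp
  qed
  have in_l2: "T' g \<in> l2 S" if g: "g \<in> l2 S" for g
  proof -
    have "(\<lambda>x. (cmod (T' g x))\<^sup>2) summable_on S"
      by (rule nonneg_bdd_above_summable_on, simp,
          rule bdd_aboveI2[where M = "(C * l2_norm S g)\<^sup>2"]) (use truncation[OF g] in auto)
    then show ?thesis
      using g by (simp add: l2_def T'_def)
  qed
  have "T' \<in> bounded_ops S"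
  proof (rule bounded_opsI[where C = C])
    fix g assume g: "g \<in> l2 S"
    have "(l2_norm S (T' g))\<^sup>2 \<le> (C * l2_norm S g)\<^sup>2"
      unfolding l2_norm_sq[of S "T' g"]
      by (rule infsum_le_finite_sums[OF l2_summable[OF in_l2[OF g]] truncation[OF g]])
    then show "l2_norm S (T' g) \<le> C * l2_norm S g"
      by (rule power2_le_imp_le) (simp add: C(1) l2_norm_nonneg)
  next
    fix f g assume "f \<in> l2 S" "g \<in> l2 S"
    then show "T' (\<lambda>x. f x + g x) = (\<lambda>x. T' f x + T' g x)"
      by (simp add: T'_def l2_add fun_eq_iff l2_inner_add_left bounded_op_in_l2[OF T] delta_in_l2)
  next
    fix c f assume "f \<in> l2 S"
    then show "T' (\<lambda>x. c * f x) = (\<lambda>x. c * T' f x)"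
      by (simp add: T'_def l2_scale fun_eq_iff l2_inner_scale_left)
  qed (use in_l2 in \<open>simp_all add: T'_def\<close>)
  moreover have "l2_inner S (T f) g = l2_inner S f (T' g)" if "f \<in> l2 S" "g \<in> l2 S" for f g
    unfolding l2_inner_def[of S f] using infsumI[OF expand[OF that]] by simp
  ultimately show ?thesis by blast
qed

lemma adjoint_unique:
  assumes "T' \<in> bounded_ops S" "T'' \<in> bounded_ops S"
    and "\<And>f g. f \<in> l2 S \<Longrightarrow> g \<in> l2 S \<Longrightarrow> l2_inner S f (T' g) = l2_inner S f (T'' g)"
  shows "T' = T''"
proof (rule bounded_op_eqI[OF assms(1,2)])
  fix g assume g: "g \<in> l2 S"
  show "T' g = T'' g"
  proof (rule l2_eqI[OF bounded_op_in_l2[OF assms(1) g] bounded_op_in_l2[OF assms(2) g]])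
    fix x assume "x \<in> S"
    have "l2_inner S (T' g) (delta x) = l2_inner S (T'' g) (delta x)"
      using assms(3)[OF delta_in_l2[OF \<open>x \<in> S\<close>] g] l2_inner_commute by metis
    then show "T' g x = T'' g x"
      using \<open>x \<in> S\<close> by (simp add: l2_inner_delta_right)
  qed
qed

lemma
  assumes T: "T \<in> bounded_ops S"
  shows adj_op_bounded: "adj_op S T \<in> bounded_ops S"
    and adj_op_inner:
      "f \<in> l2 S \<Longrightarrow> g \<in> l2 S \<Longrightarrow> l2_inner S (T f) g = l2_inner S f (adj_op S T g)"
proof -
  have "\<exists>!T'. T' \<in> bounded_ops S \<and>
      (\<forall>f\<in>l2 S. \<forall>g\<in>l2 S. l2_inner S (T f) g = l2_inner S f (T' g))"
    using adjoint_exists[OF T] adjoint_unique by (smt (verit, best))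
  from theI'[OF this]
  show "adj_op S T \<in> bounded_ops S"
    "f \<in> l2 S \<Longrightarrow> g \<in> l2 S \<Longrightarrow> l2_inner S (T f) g = l2_inner S f (adj_op S T g)"
    unfolding adj_op_def by blast+
qed

lemma adj_op_eqI:
  assumes "T \<in> bounded_ops S" "T' \<in> bounded_ops S"
    and "\<And>f g. f \<in> l2 S \<Longrightarrow> g \<in> l2 S \<Longrightarrow> l2_inner S (T f) g = l2_inner S f (T' g)"
  shows "adj_op S T = T'"
  by (rule adjoint_unique[OF adj_op_bounded[OF assms(1)] assms(2)])
     (use adj_op_inner[OF assms(1)] assms(3) in metis)

lemma adj_op_adj_op: "T \<in> bounded_ops S \<Longrightarrow> adj_op S (adj_op S T) = T"
  by (rule adj_op_eqI) (auto simp: adj_op_bounded, metis adj_op_inner l2_inner_commute)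

lemma adj_op_compose:
  assumes T: "T \<in> bounded_ops S" and U: "U \<in> bounded_ops S"
  shows "adj_op S (compose (l2 S) T U) = compose (l2 S) (adj_op S U) (adj_op S T)"
proof (rule adj_op_eqI)
  show "l2_inner S (compose (l2 S) T U f) g
      = l2_inner S f (compose (l2 S) (adj_op S U) (adj_op S T) g)"
    if "f \<in> l2 S" "g \<in> l2 S" for f g
    using that by (simp add: compose_def adj_op_inner T U bounded_op_in_l2 adj_op_bounded)
qed (simp_all add: compose_bounded_ops adj_op_bounded T U)

lemma unitary_op_iff:
  "unitary_op S U \<longleftrightarrow> U \<in> bounded_ops S \<and> (\<forall>f\<in>l2 S. adj_op S U (U f) = f) \<and>
    (\<forall>f\<in>l2 S. U (adj_op S U f) = f)"
  unfolding unitary_op_def by (auto simp: compose_def restrict_def fun_eq_iff)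

lemma unitary_op_bounded: "unitary_op S U \<Longrightarrow> U \<in> bounded_ops S"
  by (simp add: unitary_op_def)

lemma unitary_op_adj: "unitary_op S U \<Longrightarrow> unitary_op S (adj_op S U)"
  by (simp add: unitary_op_iff adj_op_bounded adj_op_adj_op)

lemma unitary_op_norm:
  assumes U: "unitary_op S U" and f: "f \<in> l2 S"
  shows "l2_norm S (U f) = l2_norm S f"
proof -
  have "l2_inner S (U f) (U f) = l2_inner S f f"
    using U f by (simp add: unitary_op_iff adj_op_inner bounded_op_in_l2)
  then have "(l2_norm S (U f))\<^sup>2 = (l2_norm S f)\<^sup>2"
    using f bounded_op_in_l2[OF unitary_op_bounded[OF U] f]
    by (simp only: l2_inner_self of_real_eq_iff)
  then show ?thesis
    by (simp add: l2_norm_nonneg)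
qed

lemma commutant_iff:
  "T \<in> commutant S X \<longleftrightarrow> T \<in> bounded_ops S \<and> (\<forall>U\<in>X. \<forall>f\<in>l2 S. T (U f) = U (T f))"
  unfolding commutant_def compose_def restrict_def by (auto simp: fun_eq_iff)

lemma commutant_antimono: "X \<subseteq> Y \<Longrightarrow> commutant S Y \<subseteq> commutant S X"
  unfolding commutant_def by blast

lemma bicommutant_mono: "X \<subseteq> Y \<Longrightarrow> bicommutant S X \<subseteq> bicommutant S Y"
  unfolding bicommutant_def by (intro commutant_antimono)

lemma bicommutant_bounded: "bicommutant S X \<subseteq> bounded_ops S"
  by (auto simp: bicommutant_def commutant_iff)

lemma subset_bicommutant: "X \<subseteq> bounded_ops S \<Longrightarrow> X \<subseteq> bicommutant S X"
  by (auto simp: bicommutant_def commutant_iff)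

lemma bicommutant_bicommutant: "bicommutant S (bicommutant S X) = bicommutant S X"
proof -
  have "commutant S (bicommutant S X) \<supseteq> commutant S X"
    by (auto simp: bicommutant_def commutant_iff)
  then show ?thesis
    using subset_bicommutant[OF bicommutant_bounded, of S X] commutant_antimono
    unfolding bicommutant_def by blast
qed

lemma compose_commutant:
  assumes "T \<in> commutant S X" "U \<in> commutant S X" and X: "X \<subseteq> bounded_ops S"
  shows "compose (l2 S) T U \<in> commutant S X"
  unfolding commutant_iff
proof (intro conjI ballI)
  fix V f assume V: "V \<in> X" and f: "f \<in> l2 S"
  have "V f \<in> l2 S" "U f \<in> l2 S"
    using V X f assms(2) bounded_op_in_l2 by (blast, auto simp: commutant_iff bounded_op_in_l2)
  then show "compose (l2 S) T U (V f) = V (compose (l2 S) T U f)"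
    using assms(1,2) V f by (simp add: commutant_iff compose_def)
qed (use assms compose_bounded_ops in \<open>auto simp: commutant_iff\<close>)

lemma adj_commutant:
  assumes X: "X \<subseteq> bounded_ops S" and adj: "\<And>U. U \<in> X \<Longrightarrow> adj_op S U \<in> X"
    and T: "T \<in> commutant S X"
  shows "adj_op S T \<in> commutant S X"
proof -
  have T': "T \<in> bounded_ops S" using T by (simp add: commutant_iff)
  have "compose (l2 S) (adj_op S T) U = compose (l2 S) U (adj_op S T)" if U: "U \<in> X" for U
  proof -
    have b: "adj_op S U \<in> bounded_ops S" and UU: "adj_op S (adj_op S U) = U"
      using X adj U adj_op_adj_op by blast+
    have "compose (l2 S) T (adj_op S U) = compose (l2 S) (adj_op S U) T"
      using T adj[OF U] by (simp add: commutant_def)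
    then show ?thesis
      using adj_op_compose[OF T' b] adj_op_compose[OF b T'] UU by simp
  qed
  then show ?thesis
    by (simp add: commutant_def adj_op_bounded[OF T'])
qed

lemma adj_bicommutant:
  assumes "X \<subseteq> bounded_ops S" "\<And>U. U \<in> X \<Longrightarrow> adj_op S U \<in> X" "T \<in> bicommutant S X"
  shows "adj_op S T \<in> bicommutant S X"
  unfolding bicommutant_def
proof (rule adj_commutant)
  show "commutant S X \<subseteq> bounded_ops S"
    by (auto simp: commutant_iff)
  show "adj_op S U \<in> commutant S X" if "U \<in> commutant S X" for U
    by (rule adj_commutant[OF assms(1,2) that])
qed (use assms(3) in \<open>simp add: bicommutant_def\<close>)

lemma von_neumann_algebra_bicommutant:
  assumes "X \<subseteq> bounded_ops S" "\<And>U. U \<in> X \<Longrightarrow> adj_op S U \<in> X"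
  shows "von_neumann_algebra S (bicommutant S X)"
  unfolding von_neumann_algebra_def
  using bicommutant_bounded adj_bicommutant[OF assms] bicommutant_bicommutant by blast

section \<open>Group von Neumann algebras and Fourier coefficients\<close>

definition perm_op :: "'a set \<Rightarrow> ('a \<Rightarrow> 'a) \<Rightarrow> 'a l2_op" where
  "perm_op S \<sigma> = (\<lambda>f\<in>l2 S. \<lambda>x. if x \<in> S then f (\<sigma> x) else 0)"

lemma perm_op_bounded:
  assumes \<sigma>: "bij_betw \<sigma> S S"
  shows "perm_op S \<sigma> \<in> bounded_ops S"
proof (rule bounded_opsI[where C = 1])
  fix f assume f: "f \<in> l2 S"
  have "(\<lambda>x. (cmod (f (\<sigma> x)))\<^sup>2) summable_on S"
    using summable_on_reindex_bij_betw[OF \<sigma>, of "\<lambda>x. (cmod (f x))\<^sup>2"] l2_summable[OF f] by simp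
  then have "(\<lambda>x. (cmod (perm_op S \<sigma> f x))\<^sup>2) summable_on S"
    using f by (subst summable_on_cong) (auto simp: perm_op_def)
  then show "perm_op S \<sigma> f \<in> l2 S"
    using f by (simp add: l2_def perm_op_def)
  have "(\<Sum>\<^sub>\<infinity>x\<in>S. (cmod (perm_op S \<sigma> f x))\<^sup>2) = (\<Sum>\<^sub>\<infinity>x\<in>S. (cmod (f (\<sigma> x)))\<^sup>2)"
    using f by (intro infsum_cong) (simp add: perm_op_def)
  also have "\<dots> = (\<Sum>\<^sub>\<infinity>x\<in>S. (cmod (f x))\<^sup>2)"
    by (rule infsum_reindex_bij_betw[OF \<sigma>])
  finally show "l2_norm S (perm_op S \<sigma> f) \<le> 1 * l2_norm S f"
    by (simp add: l2_norm_def)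
qed (auto simp: perm_op_def l2_add l2_scale fun_eq_iff)

lemma cutoff_op_bounded: "restrict (cutoff A) (l2 S) \<in> bounded_ops S"
proof (rule bounded_opsI[where C = 1])
  fix f assume f: "f \<in> l2 S"
  have "(\<Sum>\<^sub>\<infinity>x\<in>S. (cmod (cutoff A f x))\<^sup>2) \<le> (\<Sum>\<^sub>\<infinity>x\<in>S. (cmod (f x))\<^sup>2)"
    by (rule infsum_mono[OF l2_summable[OF l2_cutoff[OF f]] l2_summable[OF f]])
       (simp add: cutoff_def)
  then show "l2_norm S (restrict (cutoff A) (l2 S) f) \<le> 1 * l2_norm S f"
    using f by (simp add: l2_norm_def)
qed (simp_all add: l2_cutoff l2_add l2_scale, auto simp: cutoff_def fun_eq_iff)

context group
begin

lemma inv_mult_cancel [simp]: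
  assumes "x \<in> carrier G" "y \<in> carrier G"
  shows "inv x \<otimes> (x \<otimes> y) = y" "x \<otimes> (inv x \<otimes> y) = y"
  using assms by (simp_all add: m_assoc[symmetric])

lemma bij_betw_mult_left:
  assumes "g \<in> carrier G"
  shows "bij_betw (\<lambda>x. g \<otimes> x) (carrier G) (carrier G)"
  by (rule bij_betw_byWitness[where f' = "\<lambda>x. inv g \<otimes> x"])
     (use assms in \<open>auto simp: m_assoc\<close>)

lemma bij_betw_mult_right:
  assumes "g \<in> carrier G"
  shows "bij_betw (\<lambda>x. x \<otimes> g) (carrier G) (carrier G)"
  by (rule bij_betw_byWitness[where f' = "\<lambda>x. x \<otimes> inv g"])
     (use assms in \<open>auto simp: m_assoc\<close>)

lemma left_regular_perm_op: "left_regular G g = perm_op (carrier G) (\<lambda>x. inv g \<otimes> x)"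
  by (simp add: left_regular_def perm_op_def)

lemma left_regular_bounded: "g \<in> carrier G \<Longrightarrow> left_regular G g \<in> bounded_ops (carrier G)"
  unfolding left_regular_perm_op by (rule perm_op_bounded) (simp add: bij_betw_mult_left)

lemma left_regular_apply:
  "f \<in> l2 (carrier G) \<Longrightarrow> x \<in> carrier G \<Longrightarrow> left_regular G g f x = f (inv g \<otimes> x)"
  by (simp add: left_regular_def)

lemma left_regular_delta:
  assumes "g \<in> carrier G" "x \<in> carrier G"
  shows "left_regular G g (delta x) = delta (g \<otimes> x)"
proof
  fix y
  show "left_regular G g (delta x) y = delta (g \<otimes> x) y"
  proof (cases "y \<in> carrier G")
    case True
    then have "inv g \<otimes> y = x \<longleftrightarrow> y = g \<otimes> x"
      using assms inv_solve_left'[of x g y] by auto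
    then show ?thesis
      using assms True by (simp add: left_regular_apply delta_in_l2) (simp add: delta_def)
  next
    case False
    then have "y \<noteq> g \<otimes> x"
      using assms by auto
    then show ?thesis
      using assms False by (simp add: left_regular_def delta_in_l2)
  qed
qed

lemma left_regular_inverse:
  assumes "g \<in> carrier G" "f \<in> l2 (carrier G)"
  shows "left_regular G (inv g) (left_regular G g f) = f"
    and "left_regular G g (left_regular G (inv g) f) = f"
proof -
  have *: "left_regular G h (left_regular G (inv h) f) = f" if h: "h \<in> carrier G" for h
  proof (rule l2_eqI)
    show "left_regular G h (left_regular G (inv h) f) \<in> l2 (carrier G)"
      using assms h by (intro bounded_op_in_l2[OF left_regular_bounded]) auto
    fix x assume x: "x \<in> carrier G"
    show "left_regular G h (left_regular G (inv h) f) x = f x"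
      using assms h x bounded_op_in_l2[OF left_regular_bounded, of "inv h" f]
      by (simp add: left_regular_apply)
  qed (rule assms(2))
  show "left_regular G g (left_regular G (inv g) f) = f"
    by (rule *[OF assms(1)])
  show "left_regular G (inv g) (left_regular G g f) = f"
    using *[of "inv g"] assms(1) by simp
qed

lemma adj_left_regular:
  assumes g: "g \<in> carrier G"
  shows "adj_op (carrier G) (left_regular G g) = left_regular G (inv g)"
proof (rule adj_op_eqI)
  fix f f' assume f: "f \<in> l2 (carrier G)" "f' \<in> l2 (carrier G)"
  have "l2_inner (carrier G) f (left_regular G (inv g) f')
      = (\<Sum>\<^sub>\<infinity>x\<in>carrier G. f x * cnj (f' (g \<otimes> x)))"
    unfolding l2_inner_def using f g by (intro infsum_cong) (simp add: left_regular_apply)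
  also have "\<dots> = (\<Sum>\<^sub>\<infinity>x\<in>carrier G. f (inv g \<otimes> (g \<otimes> x)) * cnj (f' (g \<otimes> x)))"
    using g by (intro infsum_cong) simp
  also have "\<dots> = (\<Sum>\<^sub>\<infinity>x\<in>carrier G. f (inv g \<otimes> x) * cnj (f' x))"
    by (rule infsum_reindex_bij_betw[OF bij_betw_mult_left[OF g]])
  also have "\<dots> = l2_inner (carrier G) (left_regular G g f) f'"
    unfolding l2_inner_def using f g by (intro infsum_cong) (simp add: left_regular_apply)
  finally show "l2_inner (carrier G) (left_regular G g f) f'
      = l2_inner (carrier G) f (left_regular G (inv g) f')" by simp
qed (use g in \<open>simp_all add: left_regular_bounded\<close>)

lemma left_regular_unitary: "g \<in> carrier G \<Longrightarrow> unitary_op (carrier G) (left_regular G g)"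
  by (simp add: unitary_op_iff left_regular_bounded adj_left_regular left_regular_inverse)

lemma left_regular_image_bounded:
  "K \<subseteq> carrier G \<Longrightarrow> left_regular G ` K \<subseteq> bounded_ops (carrier G)"
  using left_regular_bounded by blast

lemma group_vna_bounded: "T \<in> group_vna G K \<Longrightarrow> T \<in> bounded_ops (carrier G)"
  unfolding group_vna_def using bicommutant_bounded by blast

lemma von_neumann_algebra_group_vna:
  assumes "subgroup K G"
  shows "von_neumann_algebra (carrier G) (group_vna G K)"
  unfolding group_vna_def
proof (rule von_neumann_algebra_bicommutant)
  show "adj_op (carrier G) U \<in> left_regular G ` K" if "U \<in> left_regular G ` K" for U
    using that assms by (auto simp: adj_left_regular subgroup.mem_carrier subgroup.m_inv_closed)
qed (use assms left_regular_image_bounded subgroup.subset in blast)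

lemma group_vna_mono: "K \<subseteq> L \<Longrightarrow> group_vna G K \<subseteq> group_vna G L"
  unfolding group_vna_def by (intro bicommutant_mono image_mono)

lemma left_regular_in_group_vna:
  "K \<subseteq> carrier G \<Longrightarrow> k \<in> K \<Longrightarrow> left_regular G k \<in> group_vna G K"
  unfolding group_vna_def using subset_bicommutant[OF left_regular_image_bounded] by blast

lemma compose_group_vna:
  assumes "T \<in> group_vna G K" "U \<in> group_vna G K"
  shows "compose (l2 (carrier G)) T U \<in> group_vna G K"
  using assms unfolding group_vna_def bicommutant_def
  by (rule compose_commutant) (auto simp: commutant_iff)

lemma adj_group_vna:
  "subgroup K G \<Longrightarrow> T \<in> group_vna G K \<Longrightarrow> adj_op (carrier G) T \<in> group_vna G K"
  using von_neumann_algebra_group_vna unfolding von_neumann_algebra_def by blast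

lemma group_vna_commutes:
  assumes "T \<in> group_vna G K" "U \<in> bounded_ops (carrier G)"
    and "\<And>k f. k \<in> K \<Longrightarrow> f \<in> l2 (carrier G) \<Longrightarrow> U (left_regular G k f) = left_regular G k (U f)"
    and "f \<in> l2 (carrier G)"
  shows "T (U f) = U (T f)"
  using assms by (simp add: group_vna_def bicommutant_def commutant_iff)

text \<open>
  Restriction to a set invariant under left multiplication by \<open>K\<close>, such as \<open>K\<close> itself or a
  right coset of \<open>K\<close>, commutes with \<open>\<lambda>(K)\<close> and hence with \<open>L(K)\<close>.
\<close>

lemma group_vna_cutoff:
  assumes T: "T \<in> group_vna G K" and K: "K \<subseteq> carrier G"
    and A: "\<And>k x. k \<in> K \<Longrightarrow> x \<in> carrier G \<Longrightarrow> inv k \<otimes> x \<in> A \<longleftrightarrow> x \<in> A"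
    and f: "f \<in> l2 (carrier G)"
  shows "T (cutoff A f) = cutoff A (T f)"
proof -
  let ?P = "restrict (cutoff A) (l2 (carrier G))"
  have "T (?P f) = ?P (T f)"
  proof (rule group_vna_commutes[OF T cutoff_op_bounded _ f])
    fix k f assume k: "k \<in> K" and f: "f \<in> l2 (carrier G)"
    have "left_regular G k f \<in> l2 (carrier G)"
      using k K f by (intro bounded_op_in_l2[OF left_regular_bounded]) auto
    then show "?P (left_regular G k f) = left_regular G k (?P f)"
      using A[OF k] f by (auto simp: left_regular_def cutoff_def l2_cutoff[unfolded cutoff_def] fun_eq_iff)
  qed
  then show ?thesis
    using f bounded_op_in_l2[OF group_vna_bounded[OF T] f] by simp
qed

text \<open>
  Left and right translations commute, so an element of \<open>L(G)\<close> is left convolution by the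
  function \<open>T \<delta>\<^sub>1\<close>, whose values are the Fourier coefficients of \<open>T\<close>.
\<close>

lemma group_vna_delta:
  assumes T: "T \<in> group_vna G (carrier G)" and x: "x \<in> carrier G" and y: "y \<in> carrier G"
  shows "T (delta x) y = T (delta \<one>) (y \<otimes> inv x)"
proof -
  let ?R = "perm_op (carrier G) (\<lambda>z. z \<otimes> inv x)"
  have R: "?R \<in> bounded_ops (carrier G)"
    using x by (intro perm_op_bounded bij_betw_mult_right) simp
  have one: "delta \<one> \<in> l2 (carrier G)"
    by (simp add: delta_in_l2)
  have "z \<otimes> inv x = \<one> \<longleftrightarrow> z = x" if "z \<in> carrier G" for z
    using that x inv_solve_right'[of \<one> z x] by auto
  then have "?R (delta \<one>) = delta x"
    using x one by (intro ext) (auto simp: perm_op_def, auto simp: delta_def)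
  moreover have "T (?R (delta \<one>)) = ?R (T (delta \<one>))"
  proof (rule group_vna_commutes[OF T R _ one])
    fix k f assume k: "k \<in> carrier G" and f: "f \<in> l2 (carrier G)"
    have "left_regular G k f \<in> l2 (carrier G)" "?R f \<in> l2 (carrier G)"
      using bounded_op_in_l2[OF left_regular_bounded[OF k] f] bounded_op_in_l2[OF R f] by simp_all
    then show "?R (left_regular G k f) = left_regular G k (?R f)"
      using f k x by (auto simp: perm_op_def left_regular_def m_assoc fun_eq_iff)
  qed
  moreover have "T (delta \<one>) \<in> l2 (carrier G)"
    by (rule bounded_op_in_l2[OF group_vna_bounded[OF T] one])
  ultimately have "T (delta x) = ?R (T (delta \<one>))" "T (delta \<one>) \<in> l2 (carrier G)"
    by simp_all
  then show ?thesis
    using y by (simp add: perm_op_def)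
qed

text \<open>
  An operator \<open>V\<close> in the commutant of \<open>\<lambda>(K)\<close> satisfies \<open>(V \<delta>\<^sub>x)(k\<^sup>-\<^sup>1 y) = (V \<delta>\<^bsub>kx\<^esub>)(y)\<close> for
  \<open>k \<in> K\<close>. With \<open>\<xi> = T \<delta>\<^sub>1\<close> supported in \<open>K\<close> this identifies the two convolution sums
  \<open>(T V \<delta>\<^sub>x)(y) = \<Sum>\<^sub>k \<xi>(k) (V \<delta>\<^sub>x)(k\<^sup>-\<^sup>1 y)\<close> and \<open>(V T \<delta>\<^sub>x)(y) = \<Sum>\<^sub>k \<xi>(k) (V \<delta>\<^bsub>kx\<^esub>)(y)\<close>.
\<close>

lemma group_vnaI_support:
  assumes T: "T \<in> group_vna G (carrier G)" and K: "K \<subseteq> carrier G"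
    and supp: "\<And>x. x \<in> carrier G \<Longrightarrow> x \<notin> K \<Longrightarrow> T (delta \<one>) x = 0"
  shows "T \<in> group_vna G K"
proof -
  have Tb: "T \<in> bounded_ops (carrier G)"
    by (rule group_vna_bounded[OF T])
  have "compose (l2 (carrier G)) T V = compose (l2 (carrier G)) V T"
    if V: "V \<in> commutant (carrier G) (left_regular G ` K)" for V
  proof -
    have Vb: "V \<in> bounded_ops (carrier G)"
      using V by (simp add: commutant_iff)
    show ?thesis
    proof (rule bounded_op_eq_on_delta)
      fix x assume x: "x \<in> carrier G"
      have dx: "delta x \<in> l2 (carrier G)"
        by (rule delta_in_l2[OF x])
      have "T (V (delta x)) = V (T (delta x))"
      proof (rule l2_eqI)
        show "T (V (delta x)) \<in> l2 (carrier G)" "V (T (delta x)) \<in> l2 (carrier G)"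
          using Tb Vb dx by (simp_all add: bounded_op_in_l2)
      next
        fix y assume y: "y \<in> carrier G"
        let ?z = "\<lambda>w. inv (w \<otimes> inv x) \<otimes> y"
        have bij: "bij_betw ?z (carrier G) (carrier G)"
          by (rule bij_betw_byWitness[where f' = "\<lambda>z. y \<otimes> inv z \<otimes> x"])
             (use x y in \<open>simp_all add: inv_mult_group m_assoc image_subset_iff\<close>)
        have "((\<lambda>z. V (delta x) z * T (delta z) y) has_sum T (V (delta x)) y) (carrier G)"
          by (rule bounded_op_has_sum[OF Tb bounded_op_in_l2[OF Vb dx]])
        then have TV: "((\<lambda>w. V (delta x) (?z w) * T (delta (?z w)) y) has_sum T (V (delta x)) y)
            (carrier G)"
          by (rule has_sum_reindex_bij_betw[OF bij, THEN iffD2])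
        have VT: "((\<lambda>w. T (delta x) w * V (delta w) y) has_sum V (T (delta x)) y) (carrier G)"
          by (rule bounded_op_has_sum[OF Vb bounded_op_in_l2[OF Tb dx]])
        have "V (delta x) (?z w) * T (delta (?z w)) y = T (delta x) w * V (delta w) y"
          if w: "w \<in> carrier G" for w
        proof -
          define k where "k = w \<otimes> inv x"
          have k: "k \<in> carrier G" "k \<otimes> x = w" "y \<otimes> inv (inv k \<otimes> y) = k"
            using x y w by (simp_all add: k_def m_assoc inv_mult_group)
          have "T (delta (?z w)) y = T (delta \<one>) k" "T (delta x) w = T (delta \<one>) k"
            using group_vna_delta[OF T, of "?z w" y] group_vna_delta[OF T x w] x y w k
            by (simp_all add: k_def)
          moreover have "V (delta x) (?z w) = V (delta w) y" if "k \<in> K"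
          proof -
            have "V (delta w) = V (left_regular G k (delta x))"
              using k x by (simp add: left_regular_delta)
            also have "\<dots> = left_regular G k (V (delta x))"
              using V that dx by (simp add: commutant_iff)
            finally show ?thesis
              using y bounded_op_in_l2[OF Vb dx] by (simp add: left_regular_apply k_def)
          qed
          ultimately show ?thesis
            using supp[OF k(1)] by (cases "k \<in> K") auto
        qed
        then have "((\<lambda>w. T (delta x) w * V (delta w) y) has_sum T (V (delta x)) y) (carrier G)"
          using TV by (subst has_sum_cong) auto
        then show "T (V (delta x)) y = V (T (delta x)) y"
          using VT has_sum_unique by blast
      qed
      then show "compose (l2 (carrier G)) T V (delta x) = compose (l2 (carrier G)) V T (delta x)"
        using dx by (simp add: compose_def)
    qed (simp_all add: compose_bounded_ops Tb Vb)
  qed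
  then show ?thesis
    using Tb by (simp add: group_vna_def bicommutant_def commutant_def)
qed

lemma group_vna_support:
  assumes K: "subgroup K G" and T: "T \<in> group_vna G K" and x: "x \<notin> K"
  shows "T (delta \<one>) x = 0"
proof -
  have "inv k \<otimes> y \<in> K \<longleftrightarrow> y \<in> K" if "k \<in> K" "y \<in> carrier G" for k y
  proof
    assume "inv k \<otimes> y \<in> K"
    then have "k \<otimes> (inv k \<otimes> y) \<in> K"
      using that subgroup.m_closed[OF K] by blast
    then show "y \<in> K"
      using that subgroup.mem_carrier[OF K] by simp
  qed (use that subgroup.m_inv_closed[OF K] subgroup.m_closed[OF K] in blast)
  then have "T (cutoff K (delta \<one>)) = cutoff K (T (delta \<one>))"
    by (intro group_vna_cutoff[OF T subgroup.subset[OF K]]) (auto simp: delta_in_l2)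
  moreover have "cutoff K (delta \<one>) = delta \<one>"
    using subgroup.one_closed[OF K] by (auto simp: cutoff_def delta_def)
  ultimately show ?thesis
    using x by (metis cutoff_def)
qed

lemma group_vna_subset_iff:
  assumes K: "subgroup K G" and L: "subgroup L G"
  shows "group_vna G K \<subseteq> group_vna G L \<longleftrightarrow> K \<subseteq> L"
proof
  assume sub: "group_vna G K \<subseteq> group_vna G L"
  show "K \<subseteq> L"
  proof
    fix k assume k: "k \<in> K"
    then have kc: "k \<in> carrier G"
      using K by (simp add: subgroup.mem_carrier)
    have "left_regular G k \<in> group_vna G L"
      using sub left_regular_in_group_vna[OF subgroup.subset[OF K] k] by blast
    moreover have "left_regular G k (delta \<one>) k \<noteq> 0"
      using kc by (simp add: left_regular_delta)
    ultimately show "k \<in> L"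
      using group_vna_support[OF L] by blast
  qed
qed (rule group_vna_mono)

section \<open>Maximality\<close>

lemma left_regular_commute:
  assumes "g \<in> carrier G" "h \<in> carrier G" "g \<otimes> h = h \<otimes> g" "f \<in> l2 (carrier G)"
  shows "left_regular G g (left_regular G h f) = left_regular G h (left_regular G g f)"
proof (rule l2_eqI)
  note l2 = bounded_op_in_l2[OF left_regular_bounded]
  show "left_regular G g (left_regular G h f) \<in> l2 (carrier G)"
    "left_regular G h (left_regular G g f) \<in> l2 (carrier G)"
    using assms l2 by simp_all
  fix x assume x: "x \<in> carrier G"
  have "inv h \<otimes> (inv g \<otimes> x) = inv (g \<otimes> h) \<otimes> x"
    using assms(1,2) x by (simp add: inv_mult_group m_assoc)
  also have "\<dots> = inv (h \<otimes> g) \<otimes> x"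
    by (simp only: assms(3))
  also have "\<dots> = inv g \<otimes> (inv h \<otimes> x)"
    using assms(1,2) x by (simp add: inv_mult_group m_assoc)
  finally have "inv h \<otimes> (inv g \<otimes> x) = inv g \<otimes> (inv h \<otimes> x)" .
  then show "left_regular G g (left_regular G h f) x = left_regular G h (left_regular G g f) x"
    using assms x l2 by (simp add: left_regular_apply)
qed

text \<open>
  The commutant is applied twice: \<open>\<lambda>(H)\<close> commutes with itself, so \<open>L(H)\<close> commutes with \<open>\<lambda>(H)\<close>,
  and therefore with \<open>L(H)\<close>.
\<close>

lemma abelian_group_vna:
  assumes H: "H \<subseteq> carrier G" and comm: "\<And>h k. h \<in> H \<Longrightarrow> k \<in> H \<Longrightarrow> h \<otimes> k = k \<otimes> h"
  shows "abelian_ops (carrier G) (group_vna G H)"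
proof -
  have commute: "T (U f) = U (T f)"
    if T: "T \<in> group_vna G H" and U: "U \<in> group_vna G H" and f: "f \<in> l2 (carrier G)" for T U f
  proof (rule group_vna_commutes[OF T group_vna_bounded[OF U] _ f])
    fix k f' assume k: "k \<in> H" and f': "f' \<in> l2 (carrier G)"
    show "U (left_regular G k f') = left_regular G k (U f')"
    proof (rule group_vna_commutes[OF U left_regular_bounded _ f'])
      fix h f'' assume h: "h \<in> H" and f'': "f'' \<in> l2 (carrier G)"
      have "k \<in> carrier G" "h \<in> carrier G"
        using h k H by blast+
      then show "left_regular G k (left_regular G h f'') = left_regular G h (left_regular G k f'')"
        by (rule left_regular_commute[OF _ _ comm[OF k h] f''])
    qed (use k H in blast)
  qed
  show ?thesis
    unfolding abelian_ops_def compose_def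
  proof (intro ballI restrict_ext)
    fix T U f
    assume "T \<in> group_vna G H" "U \<in> group_vna G H" "f \<in> l2 (carrier G)"
    then show "T (U f) = U (T f)"
      by (rule commute)
  qed
qed

text \<open>
  Commuting with \<open>\<lambda>\<^sub>h\<close> makes the Fourier coefficients invariant under conjugation by \<open>h\<close>, and a
  square-summable function that is constant on an infinite set vanishes there.
\<close>

lemma coefficient_zero_on_infinite_orbit:
  assumes T: "T \<in> group_vna G (carrier G)" and H: "H \<subseteq> carrier G" and g: "g \<in> carrier G"
    and comm: "\<And>h. h \<in> H \<Longrightarrow> T (left_regular G h (delta \<one>)) = left_regular G h (T (delta \<one>))"
    and inf: "infinite {h \<otimes> g \<otimes> inv h | h. h \<in> H}"
  shows "T (delta \<one>) g = 0"
proof (rule ccontr)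
  let ?\<xi> = "T (delta \<one>)" and ?O = "{h \<otimes> g \<otimes> inv h | h. h \<in> H}"
  assume nz: "?\<xi> g \<noteq> 0"
  have \<xi>: "?\<xi> \<in> l2 (carrier G)"
    by (simp add: bounded_op_in_l2[OF group_vna_bounded[OF T]] delta_in_l2)
  have const: "?\<xi> (h \<otimes> g \<otimes> inv h) = ?\<xi> g" if h: "h \<in> H" for h
  proof -
    have hc: "h \<in> carrier G" using h H by blast
    have "?\<xi> (h \<otimes> g \<otimes> inv h) = T (delta h) (h \<otimes> g)"
      using hc g by (simp add: group_vna_delta[OF T, of h])
    also have "\<dots> = left_regular G h ?\<xi> (h \<otimes> g)"
      using comm[OF h] hc by (simp add: left_regular_delta)
    finally show ?thesis
      using hc g \<xi> by (simp add: left_regular_apply)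
  qed
  have sub: "?O \<subseteq> carrier G"
    using H g by auto
  have "finite ((\<lambda>x. {x}) ` ?O)"
  proof (rule finite_family_of_equal_mass[OF \<xi>, where m = "cmod (?\<xi> g)"])
    fix A assume "A \<in> (\<lambda>x. {x}) ` ?O"
    then obtain h where h: "h \<in> H" and A: "A = {h \<otimes> g \<otimes> inv h}" by blast
    show "A \<subseteq> carrier G"
      using A h H g by auto
    then have "(l2_norm (carrier G) (cutoff A ?\<xi>))\<^sup>2 = (cmod (?\<xi> g))\<^sup>2"
      by (simp add: l2_norm_cutoff) (simp add: A const[OF h])
    then show "l2_norm (carrier G) (cutoff A ?\<xi>) = cmod (?\<xi> g)"
      by (simp add: l2_norm_nonneg)
  qed (use nz in \<open>auto simp: pairwise_def\<close>)
  then show False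
    using inf finite_imageD[of "\<lambda>x. {x}" ?O] by (simp add: inj_on_def)
qed

lemma masa_group_vna:
  assumes H: "subgroup H G" and comm: "\<And>h k. h \<in> H \<Longrightarrow> k \<in> H \<Longrightarrow> h \<otimes> k = k \<otimes> h"
    and inf: "\<And>g. g \<in> carrier G - H \<Longrightarrow> infinite {h \<otimes> g \<otimes> inv h | h. h \<in> H}"
  shows "masa (carrier G) (group_vna G H) (group_vna G (carrier G))"
proof -
  note HG = subgroup.subset[OF H]
  have maximal: "A \<subseteq> group_vna G H"
    if ab: "abelian_ops (carrier G) A" and BA: "group_vna G H \<subseteq> A"
      and AM: "A \<subseteq> group_vna G (carrier G)" for A
  proof
    fix T assume T: "T \<in> A"
    have commutes: "T (left_regular G h (delta \<one>)) = left_regular G h (T (delta \<one>))"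
      if "h \<in> H" for h
    proof -
      have "compose (l2 (carrier G)) T (left_regular G h)
          = compose (l2 (carrier G)) (left_regular G h) T"
        by (rule ab[unfolded abelian_ops_def, rule_format, OF T
              subsetD[OF BA left_regular_in_group_vna[OF HG that]]])
      then have "compose (l2 (carrier G)) T (left_regular G h) (delta \<one>)
          = compose (l2 (carrier G)) (left_regular G h) T (delta \<one>)" by simp
      then show ?thesis
        by (simp add: compose_def delta_in_l2)
    qed
    have "T (delta \<one>) x = 0" if "x \<in> carrier G" "x \<notin> H" for x
    proof (rule coefficient_zero_on_infinite_orbit[OF _ HG that(1) commutes])
      show "T \<in> group_vna G (carrier G)"
        using T AM by blast
      show "infinite {h \<otimes> x \<otimes> inv h | h. h \<in> H}"
        by (rule inf) (use that in blast)
    qed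
    then show "T \<in> group_vna G H"
      by (rule group_vnaI_support[OF subsetD[OF AM T] HG])
  qed
  show ?thesis
    unfolding masa_def
  proof (intro conjI allI impI)
    show "von_neumann_algebra (carrier G) (group_vna G H)"
      by (rule von_neumann_algebra_group_vna[OF H])
    show "group_vna G H \<subseteq> group_vna G (carrier G)"
      by (rule group_vna_mono[OF HG])
    show "abelian_ops (carrier G) (group_vna G H)"
      by (rule abelian_group_vna[OF HG comm])
    fix A
    assume "von_neumann_algebra (carrier G) A \<and> abelian_ops (carrier G) A \<and>
      group_vna G H \<subseteq> A \<and> A \<subseteq> group_vna G (carrier G)"
    then show "A = group_vna G H"
      using maximal[of A] by blast
  qed
qed

end

section \<open>The normalizer\<close>

lemma finite_image_if_determined:
  assumes "finite (f ` A)" and det: "\<And>a b. a \<in> A \<Longrightarrow> b \<in> A \<Longrightarrow> f a = f b \<Longrightarrow> g a = g b"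
  shows "finite (g ` A)"
proof -
  have "g a = g (inv_into A f (f a))" if "a \<in> A" for a
    by (rule det) (use that in \<open>auto simp: inv_into_into f_inv_into_f\<close>)
  then have "g ` A = (\<lambda>y. g (inv_into A f y)) ` f ` A"
    unfolding image_image by (rule image_cong[OF refl])
  then show ?thesis
    using assms(1) by simp
qed

text \<open>
  Conjugation by \<open>U\<^sup>*\<close> inverts conjugation by \<open>U\<close>. So equality \<open>U B U\<^sup>* = B\<close> amounts to
  two inclusions that are exchanged by passing from \<open>U\<close> to \<open>U\<^sup>*\<close>, which makes the unitary
  normalizer closed under adjoints.
\<close>

lemma conj_unitary_inverse:
  assumes U: "unitary_op S U" and T: "T \<in> bounded_ops S"
  shows "compose (l2 S) U (compose (l2 S)
    (compose (l2 S) (adj_op S U) (compose (l2 S) T U)) (adj_op S U)) = T"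
proof (rule bounded_op_eqI)
  have b: "U \<in> bounded_ops S" "adj_op S U \<in> bounded_ops S"
    using U by (simp_all add: unitary_op_bounded adj_op_bounded)
  then show "compose (l2 S) U (compose (l2 S)
      (compose (l2 S) (adj_op S U) (compose (l2 S) T U)) (adj_op S U)) \<in> bounded_ops S"
    by (intro compose_bounded_ops T)
  show "compose (l2 S) U (compose (l2 S)
      (compose (l2 S) (adj_op S U) (compose (l2 S) T U)) (adj_op S U)) f = T f"
    if f: "f \<in> l2 S" for f
    using U f bounded_op_in_l2[OF b(2) f] bounded_op_in_l2[OF T f]
    by (simp add: compose_def unitary_op_iff)
qed (rule T)

lemma unitary_normalizer_iff:
  assumes B: "B \<subseteq> bounded_ops S"
  shows "U \<in> unitary_normalizer S M B \<longleftrightarrow> U \<in> M \<and> unitary_op S U \<and>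
    (\<forall>T\<in>B. compose (l2 S) U (compose (l2 S) T (adj_op S U)) \<in> B) \<and>
    (\<forall>T\<in>B. compose (l2 S) (adj_op S U) (compose (l2 S) T U) \<in> B)"
    (is "_ \<longleftrightarrow> _ \<and> _ \<and> (\<forall>T\<in>B. ?c T \<in> B) \<and> (\<forall>T\<in>B. ?d T \<in> B)")
proof (cases "unitary_op S U")
  case True
  have cd: "?c (?d T) = T" if "T \<in> B" for T
    using conj_unitary_inverse[OF True] B that by blast
  have dc: "?d (?c T) = T" if "T \<in> B" for T
    using conj_unitary_inverse[OF unitary_op_adj[OF True], of T] B that
    by (simp add: adj_op_adj_op unitary_op_bounded[OF True] subset_iff)
  have "?c ` B = B \<longleftrightarrow> (\<forall>T\<in>B. ?c T \<in> B) \<and> (\<forall>T\<in>B. ?d T \<in> B)"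
  proof
    assume image: "?c ` B = B"
    have "?d T \<in> B" if "T \<in> B" for T
    proof -
      obtain T' where "T' \<in> B" "T = ?c T'"
        using \<open>T \<in> B\<close> image by blast
      then show ?thesis
        using dc by simp
    qed
    then show "(\<forall>T\<in>B. ?c T \<in> B) \<and> (\<forall>T\<in>B. ?d T \<in> B)"
      using image by blast
  next
    assume stable: "(\<forall>T\<in>B. ?c T \<in> B) \<and> (\<forall>T\<in>B. ?d T \<in> B)"
    have "T \<in> ?c ` B" if "T \<in> B" for T
      using cd[OF that] stable that by (intro image_eqI[where x = "?d T"]) auto
    then show "?c ` B = B"
      using stable by blast
  qed
  then show ?thesis
    by (simp add: unitary_normalizer_def)
qed (simp add: unitary_normalizer_def)

context group
begin

lemma normalizer_iff:
  assumes H: "H \<subseteq> carrier G"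
  shows "g \<in> normalizer G H \<longleftrightarrow>
    g \<in> carrier G \<and> (\<forall>h\<in>H. g \<otimes> h \<otimes> inv g \<in> H) \<and> (\<forall>h\<in>H. inv g \<otimes> h \<otimes> g \<in> H)"
proof (cases "g \<in> carrier G")
  case True
  have image: "g <# H #> inv g = (\<lambda>h. g \<otimes> h \<otimes> inv g) ` H"
    by (auto simp: r_coset_def l_coset_def)
  have cancel: "g \<otimes> (inv g \<otimes> h \<otimes> g) \<otimes> inv g = h" "inv g \<otimes> (g \<otimes> h \<otimes> inv g) \<otimes> g = h"
    if "h \<in> H" for h
    using True H that by (auto simp: m_assoc)
  have "(\<lambda>h. g \<otimes> h \<otimes> inv g) ` H = H \<longleftrightarrow>
      (\<forall>h\<in>H. g \<otimes> h \<otimes> inv g \<in> H) \<and> (\<forall>h\<in>H. inv g \<otimes> h \<otimes> g \<in> H)"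
  proof
    assume "(\<lambda>h. g \<otimes> h \<otimes> inv g) ` H = H"
    then have sub: "(\<lambda>h. g \<otimes> h \<otimes> inv g) ` H \<subseteq> H" and sup: "H \<subseteq> (\<lambda>h. g \<otimes> h \<otimes> inv g) ` H"
      by simp_all
    have "inv g \<otimes> h \<otimes> g \<in> H" if "h \<in> H" for h
    proof -
      obtain h' where "h' \<in> H" "h = g \<otimes> h' \<otimes> inv g"
        using sup \<open>h \<in> H\<close> by blast
      then show ?thesis
        by (simp only: cancel(2))
    qed
    then show "(\<forall>h\<in>H. g \<otimes> h \<otimes> inv g \<in> H) \<and> (\<forall>h\<in>H. inv g \<otimes> h \<otimes> g \<in> H)"
      using sub by blast
  next
    assume stable: "(\<forall>h\<in>H. g \<otimes> h \<otimes> inv g \<in> H) \<and> (\<forall>h\<in>H. inv g \<otimes> h \<otimes> g \<in> H)"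
    have "h \<in> (\<lambda>h. g \<otimes> h \<otimes> inv g) ` H" if "h \<in> H" for h
      by (rule image_eqI[where x = "inv g \<otimes> h \<otimes> g"]) (use stable that cancel(1) in auto)
    then show "(\<lambda>h. g \<otimes> h \<otimes> inv g) ` H = H"
      using stable by blast
  qed
  then show ?thesis
    using True H by (simp add: normalizer_def stabilizer_def image)
qed (simp add: normalizer_def stabilizer_def)

lemma normalizer_eq_carrier_iff:
  assumes H: "subgroup H G"
  shows "normalizer G H = carrier G \<longleftrightarrow> H \<lhd> G"
proof
  note N = normalizer_iff[OF subgroup.subset[OF H]]
  show "H \<lhd> G" if "normalizer G H = carrier G"
    unfolding normal_inv_iff
  proof (intro conjI ballI H)
    fix x h assume "x \<in> carrier G" "h \<in> H"
    then show "x \<otimes> h \<otimes> inv x \<in> H"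
      using N[of x] that by simp
  qed
  show "normalizer G H = carrier G" if normal: "H \<lhd> G"
  proof (intro equalityI subsetI)
    fix x assume "x \<in> carrier G"
    then show "x \<in> normalizer G H"
      by (simp add: N normal.inv_op_closed1[OF normal] normal.inv_op_closed2[OF normal])
  qed (simp add: N)
qed

text \<open>
  Since \<open>V = U \<lambda>\<^sub>h U\<^sup>*\<close> lies in \<open>L(H)\<close>, it preserves the functions supported on a right coset of
  \<open>H\<close>. It is isometric and moves \<open>\<xi> = U \<delta>\<^sub>1\<close> to \<open>U \<delta>\<^sub>h\<close>, the right translate of \<open>\<xi>\<close>. Hence \<open>\<xi>\<close>
  has the same norm on \<open>H x\<close> as on \<open>H x h\<^sup>-\<^sup>1\<close>, and the mass of \<open>\<xi>\<close> is finite.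
\<close>

lemma finite_cosets_in_support:
  assumes H: "subgroup H G" and U: "U \<in> group_vna G (carrier G)" and unit: "unitary_op (carrier G) U"
    and normalizes: "\<And>h. h \<in> H \<Longrightarrow> compose (l2 (carrier G)) U
      (compose (l2 (carrier G)) (left_regular G h) (adj_op (carrier G) U)) \<in> group_vna G H"
    and g: "g \<in> carrier G" and nz: "U (delta \<one>) g \<noteq> 0"
  shows "finite ((\<lambda>a. H #> (g \<otimes> a)) ` H)"
proof -
  let ?S = "carrier G" and ?\<xi> = "U (delta \<one>)"
  note HG = subgroup.subset[OF H]
  have Ub: "U \<in> bounded_ops ?S" "adj_op ?S U \<in> bounded_ops ?S"
    using unit by (simp_all add: unitary_op_bounded adj_op_bounded)
  have one: "delta \<one> \<in> l2 ?S"
    by (simp add: delta_in_l2)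
  have \<xi>: "?\<xi> \<in> l2 ?S"
    by (rule bounded_op_in_l2[OF Ub(1) one])
  have coset_subset: "H #> x \<subseteq> ?S" if "x \<in> ?S" for x
    using r_coset_subset_G[OF HG that] .
  have mass: "l2_norm ?S (cutoff (H #> x) ?\<xi>) = l2_norm ?S (cutoff (H #> (x \<otimes> inv h)) ?\<xi>)"
    if x: "x \<in> ?S" and h: "h \<in> H" for x h
  proof -
    have hc: "h \<in> ?S" using h HG by blast
    define V where "V = compose (l2 ?S) U (compose (l2 ?S) (left_regular G h) (adj_op ?S U))"
    have V: "V \<in> group_vna G H"
      unfolding V_def by (rule normalizes[OF h])
    have V_norm: "l2_norm ?S (V f) = l2_norm ?S f" if f: "f \<in> l2 ?S" for f
      using f bounded_op_in_l2[OF Ub(2) f] bounded_op_in_l2[OF left_regular_bounded[OF hc]]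
      by (simp add: V_def compose_def unitary_op_norm[OF unit] unitary_op_norm[OF unitary_op_adj[OF unit]]
          unitary_op_norm[OF left_regular_unitary[OF hc]])
    have "adj_op ?S U ?\<xi> = delta \<one>"
      using unit one by (simp add: unitary_op_iff)
    then have V\<xi>: "V ?\<xi> = U (delta h)"
      using \<xi> hc by (simp add: V_def compose_def left_regular_delta)
    have "inv k \<otimes> y \<in> H #> x \<longleftrightarrow> y \<in> H #> x" if k: "k \<in> H" and y: "y \<in> ?S" for k y
    proof
      assume "inv k \<otimes> y \<in> H #> x"
      then obtain l where l: "l \<in> H" "inv k \<otimes> y = l \<otimes> x"
        by (auto simp: r_coset_def)
      then have "y = (k \<otimes> l) \<otimes> x"
        using k y x HG inv_mult_cancel(2)[of k y] by (simp add: m_assoc subset_iff)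
      then show "y \<in> H #> x"
        using k l subgroup.m_closed[OF H] by (auto simp: r_coset_def)
    next
      assume "y \<in> H #> x"
      then obtain l where l: "l \<in> H" "y = l \<otimes> x"
        by (auto simp: r_coset_def)
      then have "inv k \<otimes> y = (inv k \<otimes> l) \<otimes> x"
        using k x HG by (simp add: m_assoc subset_iff)
      then show "inv k \<otimes> y \<in> H #> x"
        using k l subgroup.m_closed[OF H] subgroup.m_inv_closed[OF H] by (auto simp: r_coset_def)
    qed
    then have cut: "V (cutoff (H #> x) ?\<xi>) = cutoff (H #> x) (U (delta h))"
      using group_vna_cutoff[OF V HG _ \<xi>] V\<xi> by simp
    have bij: "bij_betw (\<lambda>y. y \<otimes> inv h) (H #> x) (H #> (x \<otimes> inv h))"
    proof (rule bij_betw_imageI)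
      show "inj_on (\<lambda>y. y \<otimes> inv h) (H #> x)"
        by (rule inj_on_subset[OF bij_betw_imp_inj_on[OF bij_betw_mult_right] coset_subset[OF x]])
           (simp add: hc)
      show "(\<lambda>y. y \<otimes> inv h) ` (H #> x) = H #> (x \<otimes> inv h)"
        using HG x hc by (auto simp: r_coset_def image_UN m_assoc subset_iff)
    qed
    have "(l2_norm ?S (cutoff (H #> x) ?\<xi>))\<^sup>2 = (l2_norm ?S (cutoff (H #> x) (U (delta h))))\<^sup>2"
      using V_norm[OF l2_cutoff[OF \<xi>], of "H #> x"] cut by simp
    also have "\<dots> = (\<Sum>\<^sub>\<infinity>y\<in>H #> x. (cmod (U (delta h) y))\<^sup>2)"
      by (rule l2_norm_cutoff[OF coset_subset[OF x]])
    also have "\<dots> = (\<Sum>\<^sub>\<infinity>y\<in>H #> x. (cmod (?\<xi> (y \<otimes> inv h)))\<^sup>2)"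
      by (rule infsum_cong) (use coset_subset[OF x] group_vna_delta[OF U hc] in auto)
    also have "\<dots> = (\<Sum>\<^sub>\<infinity>y\<in>H #> (x \<otimes> inv h). (cmod (?\<xi> y))\<^sup>2)"
      by (rule infsum_reindex_bij_betw[OF bij])
    also have "\<dots> = (l2_norm ?S (cutoff (H #> (x \<otimes> inv h)) ?\<xi>))\<^sup>2"
      by (rule l2_norm_cutoff[OF coset_subset, symmetric]) (use x hc in simp)
    finally show ?thesis
      by (simp add: l2_norm_nonneg)
  qed
  show ?thesis
  proof (rule finite_family_of_equal_mass[OF \<xi>,
        where m = "l2_norm ?S (cutoff (H #> g) ?\<xi>)"])
    have "(\<lambda>a. H #> (g \<otimes> a)) ` H \<subseteq> rcosets H"
      using g HG by (auto simp: RCOSETS_def)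
    then show "pairwise disjnt ((\<lambda>a. H #> (g \<otimes> a)) ` H)"
      using rcos_disjoint[OF H] pairwise_subset by blast
    have "cmod (cutoff (H #> g) ?\<xi> g) \<le> l2_norm ?S (cutoff (H #> g) ?\<xi>)"
      by (rule l2_coordinate_le_norm[OF l2_cutoff[OF \<xi>]])
    moreover have "cutoff (H #> g) ?\<xi> g = ?\<xi> g"
      using rcos_self[OF g H] by (simp add: cutoff_def)
    ultimately show "l2_norm ?S (cutoff (H #> g) ?\<xi>) > 0"
      using nz by (smt (verit) zero_less_norm_iff)
  next
    fix A assume "A \<in> (\<lambda>a. H #> (g \<otimes> a)) ` H"
    then obtain a where a: "a \<in> H" and A: "A = H #> (g \<otimes> a)" by blast
    show "A \<subseteq> ?S"
      unfolding A by (rule coset_subset) (use a g HG in auto)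
    show "l2_norm ?S (cutoff A ?\<xi>) = l2_norm ?S (cutoff (H #> g) ?\<xi>)"
      using mass[OF g, of "inv a"] a subgroup.m_inv_closed[OF H a] HG
      by (simp add: A subset_iff)
  qed
qed

text \<open>
  The \<open>H\<close>-conjugates of \<open>x = g\<^sup>-\<^sup>1 k g\<close> are the elements \<open>(g a)\<^sup>-\<^sup>1 k (g a)\<close> with \<open>a \<in> H\<close>. As \<open>H\<close> is
  abelian, they depend only on the coset \<open>H g a\<close>. Finitely many cosets give finitely many
  conjugates, and then \<open>x \<in> H\<close>.
\<close>

lemma conj_mem_if_finite_cosets:
  assumes H: "subgroup H G" and comm: "\<And>h k. h \<in> H \<Longrightarrow> k \<in> H \<Longrightarrow> h \<otimes> k = k \<otimes> h"
    and inf: "\<And>g. g \<in> carrier G - H \<Longrightarrow> infinite {h \<otimes> g \<otimes> inv h | h. h \<in> H}"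
    and g: "g \<in> carrier G" and fin: "finite ((\<lambda>a. H #> (g \<otimes> a)) ` H)" and k: "k \<in> H"
  shows "inv g \<otimes> k \<otimes> g \<in> H"
proof (rule ccontr)
  let ?x = "inv g \<otimes> k \<otimes> g"
  let ?conj = "\<lambda>a. inv (g \<otimes> a) \<otimes> k \<otimes> (g \<otimes> a)"
  note Hc = subgroup.mem_carrier[OF H]
  assume "?x \<notin> H"
  moreover have "?x \<in> carrier G"
    using g k Hc by simp
  moreover have "?conj a = ?conj b"
    if a: "a \<in> H" and b: "b \<in> H" and eq: "H #> (g \<otimes> a) = H #> (g \<otimes> b)" for a b
  proof -
    have "g \<otimes> a \<in> H #> (g \<otimes> b)"
      using rcos_self[OF _ H, of "g \<otimes> a"] g a Hc eq by simp
    then obtain s where s: "s \<in> H" "g \<otimes> a = s \<otimes> (g \<otimes> b)"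
      by (auto simp: r_coset_def)
    have "?conj a = inv (g \<otimes> b) \<otimes> (inv s \<otimes> (k \<otimes> s)) \<otimes> (g \<otimes> b)"
      using s(1) g b k Hc unfolding s(2) by (simp add: inv_mult_group m_assoc)
    also have "inv s \<otimes> (k \<otimes> s) = k"
      using comm[OF k s(1)] s(1) k Hc by simp
    finally show ?thesis .
  qed
  then have "finite (?conj ` H)"
    by (rule finite_image_if_determined[OF fin])
  moreover have "{h \<otimes> ?x \<otimes> inv h | h. h \<in> H} \<subseteq> ?conj ` H"
  proof
    fix y assume "y \<in> {h \<otimes> ?x \<otimes> inv h | h. h \<in> H}"
    then obtain h where h: "h \<in> H" "y = h \<otimes> ?x \<otimes> inv h" by blast
    then have "y = ?conj (inv h)"
      using g k Hc by (simp add: inv_mult_group m_assoc)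
    then show "y \<in> ?conj ` H"
      using subgroup.m_inv_closed[OF H h(1)] by blast
  qed
  ultimately show False
    using inf[of ?x] finite_subset by blast
qed

lemma adj_coefficient:
  assumes U: "U \<in> group_vna G (carrier G)" and g: "g \<in> carrier G"
  shows "adj_op (carrier G) U (delta \<one>) (inv g) = cnj (U (delta \<one>) g)"
proof -
  let ?S = "carrier G"
  note Ub = group_vna_bounded[OF U]
  have l2: "delta \<one> \<in> l2 ?S" "delta (inv g) \<in> l2 ?S"
    using g by (simp_all add: delta_in_l2)
  have "adj_op ?S U (delta \<one>) (inv g) = l2_inner ?S (adj_op ?S U (delta \<one>)) (delta (inv g))"
    using g by (simp add: l2_inner_delta_right)
  also have "\<dots> = cnj (l2_inner ?S (U (delta (inv g))) (delta \<one>))"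
    using adj_op_inner[OF Ub l2(2,1)] l2_inner_commute by metis
  also have "\<dots> = cnj (U (delta \<one>) g)"
    using g group_vna_delta[OF U, of "inv g" \<one>] by (simp add: l2_inner_delta_right)
  finally show ?thesis .
qed

text \<open>
  For a coefficient \<open>U \<delta>\<^sub>1 (g) \<noteq> 0\<close> the coset count gives only \<open>g\<^sup>-\<^sup>1 H g \<subseteq> H\<close>. The reverse
  inclusion comes from applying it to \<open>U\<^sup>*\<close>, whose coefficient at \<open>g\<^sup>-\<^sup>1\<close> is nonzero as well.
\<close>

lemma unitary_normalizer_subset:
  assumes H: "subgroup H G" and comm: "\<And>h k. h \<in> H \<Longrightarrow> k \<in> H \<Longrightarrow> h \<otimes> k = k \<otimes> h"
    and inf: "\<And>g. g \<in> carrier G - H \<Longrightarrow> infinite {h \<otimes> g \<otimes> inv h | h. h \<in> H}"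
  shows "unitary_normalizer (carrier G) (group_vna G (carrier G)) (group_vna G H)
    \<subseteq> group_vna G (normalizer G H)"
proof
  let ?S = "carrier G"
  let ?UN = "unitary_normalizer ?S (group_vna G ?S) (group_vna G H)"
  note HG = subgroup.subset[OF H]
  have bounded: "group_vna G H \<subseteq> bounded_ops ?S"
    using group_vna_bounded by blast
  note UN = unitary_normalizer_iff[OF bounded, of _ "group_vna G ?S"]
  have conj: "inv g \<otimes> k \<otimes> g \<in> H"
    if "U \<in> ?UN" "g \<in> ?S" "U (delta \<one>) g \<noteq> 0" "k \<in> H" for U g k
  proof (rule conj_mem_if_finite_cosets[OF H comm inf that(2) _ that(4)])
    show "finite ((\<lambda>a. H #> (g \<otimes> a)) ` H)"
      using that(1-3) left_regular_in_group_vna[OF HG]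
      by (intro finite_cosets_in_support[OF H, of U]) (auto simp: UN)
  qed
  fix U assume U: "U \<in> ?UN"
  then have UM: "U \<in> group_vna G ?S" and unit: "unitary_op ?S U"
    by (simp_all add: UN)
  have adj: "adj_op ?S U \<in> ?UN"
    using U by (simp add: UN unitary_op_adj adj_group_vna[OF subgroup_self]
        adj_op_adj_op[OF unitary_op_bounded[OF unit]])
  have support: "g \<in> normalizer G H" if g: "g \<in> ?S" and nz: "U (delta \<one>) g \<noteq> 0" for g
  proof -
    have "adj_op ?S U (delta \<one>) (inv g) \<noteq> 0"
      using nz by (simp add: adj_coefficient[OF UM g])
    then have "g \<otimes> k \<otimes> inv g \<in> H" if "k \<in> H" for k
      using conj[OF adj, of "inv g" k] g that by simp
    then show ?thesis
      using conj[OF U g nz] g by (simp add: normalizer_iff[OF HG])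
  qed
  show "U \<in> group_vna G (normalizer G H)"
    by (rule group_vnaI_support[OF UM subgroup.subset[OF normalizer_imp_subgroup[OF HG]]])
       (use support in blast)
qed

text \<open>
  Conjugating \<open>T\<close> by \<open>\<lambda>\<^sub>g\<close> moves its Fourier support from \<open>H\<close> to \<open>g H g\<^sup>-\<^sup>1\<close>.
\<close>

lemma conj_left_regular_in_group_vna:
  assumes H: "subgroup H G" and g: "g \<in> normalizer G H" and T: "T \<in> group_vna G H"
  shows "compose (l2 (carrier G)) (left_regular G g)
    (compose (l2 (carrier G)) T (left_regular G (inv g))) \<in> group_vna G H" (is "?T' \<in> _")
proof (rule group_vnaI_support)
  let ?S = "carrier G"
  note HG = subgroup.subset[OF H]
  have gc: "g \<in> ?S" and conj: "\<And>h. h \<in> H \<Longrightarrow> g \<otimes> h \<otimes> inv g \<in> H"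
    using g by (simp_all add: normalizer_iff[OF HG])
  have TG: "T \<in> group_vna G ?S"
    using T group_vna_mono[OF HG] by blast
  then show "?T' \<in> group_vna G ?S"
    using gc by (intro compose_group_vna left_regular_in_group_vna) auto
  show "?T' (delta \<one>) x = 0" if x: "x \<in> ?S" "x \<notin> H" for x
  proof -
    have "T (delta (inv g)) \<in> l2 ?S"
      using gc by (simp add: bounded_op_in_l2[OF group_vna_bounded[OF T]] delta_in_l2)
    then have "?T' (delta \<one>) x = T (delta (inv g)) (inv g \<otimes> x)"
      using gc x by (simp add: compose_def delta_in_l2 left_regular_delta left_regular_apply)
    also have "\<dots> = T (delta \<one>) (inv g \<otimes> x \<otimes> g)"
      using gc x by (simp add: group_vna_delta[OF TG, of "inv g"])
    also have "\<dots> = 0"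
    proof (rule group_vna_support[OF H T])
      have "g \<otimes> (inv g \<otimes> x \<otimes> g) \<otimes> inv g = x"
        using gc x by (simp add: m_assoc)
      then show "inv g \<otimes> x \<otimes> g \<notin> H"
        using conj x by metis
    qed
    finally show ?thesis .
  qed
qed (rule subgroup.subset[OF H])

lemma left_regular_in_unitary_normalizer:
  assumes H: "subgroup H G" and g: "g \<in> normalizer G H"
  shows "left_regular G g
    \<in> unitary_normalizer (carrier G) (group_vna G (carrier G)) (group_vna G H)"
proof -
  note N = normalizer_imp_subgroup[OF subgroup.subset[OF H]]
  have gc: "g \<in> carrier G"
    using subgroup.mem_carrier[OF N g] .
  have bounded: "group_vna G H \<subseteq> bounded_ops (carrier G)"
    using group_vna_bounded by blast
  show ?thesis
    using gc conj_left_regular_in_group_vna[OF H g]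
      conj_left_regular_in_group_vna[OF H subgroup.m_inv_closed[OF N g]]
    by (simp add: unitary_normalizer_iff[OF bounded] left_regular_in_group_vna
        left_regular_unitary adj_left_regular)
qed

theorem bicommutant_unitary_normalizer:
  assumes H: "subgroup H G" and comm: "\<And>h k. h \<in> H \<Longrightarrow> k \<in> H \<Longrightarrow> h \<otimes> k = k \<otimes> h"
    and inf: "\<And>g. g \<in> carrier G - H \<Longrightarrow> infinite {h \<otimes> g \<otimes> inv h | h. h \<in> H}"
  shows "bicommutant (carrier G)
      (unitary_normalizer (carrier G) (group_vna G (carrier G)) (group_vna G H))
    = group_vna G (normalizer G H)" (is "bicommutant ?S ?UN = ?LN")
proof
  have "bicommutant ?S ?UN \<subseteq> bicommutant ?S ?LN"
    by (rule bicommutant_mono[OF unitary_normalizer_subset[OF H comm inf]])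
  then show "bicommutant ?S ?UN \<subseteq> ?LN"
    by (simp add: group_vna_def bicommutant_bicommutant)
  show "?LN \<subseteq> bicommutant ?S ?UN"
    unfolding group_vna_def[of G "normalizer G H"]
    by (rule bicommutant_mono) (use left_regular_in_unitary_normalizer[OF H] in blast)
qed

end

theorem corollary5p7:
  fixes G (structure) and H :: "'a set"
  assumes "group G"
    and "subgroup H G"
    and "comm_group (G\<lparr>carrier := H\<rparr>)"
    and "\<And>g. g \<in> carrier G - H \<Longrightarrow> infinite {h \<otimes> g \<otimes> inv h | h. h \<in> H}"
  shows "masa (carrier G) (group_vna G H) (group_vna G (carrier G)) \<and>
    bicommutant (carrier G)
       (unitary_normalizer (carrier G) (group_vna G (carrier G)) (group_vna G H))
       = group_vna G (normalizer G H) \<and>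
    (singular_masa (carrier G) (group_vna G H) (group_vna G (carrier G)) \<longleftrightarrow> normalizer G H = H) \<and>
    (cartan_masa (carrier G) (group_vna G H) (group_vna G (carrier G)) \<longleftrightarrow> H \<lhd> G)"
proof -
  interpret group G by (rule assms(1))
  note H = assms(2)
  have comm: "h \<otimes> k = k \<otimes> h" if "h \<in> H" "k \<in> H" for h k
    using comm_monoid.m_comm[OF comm_group.axioms(1)[OF assms(3)]] that by simp
  note masa = masa_group_vna[OF H comm assms(4)]
  note bicomm = bicommutant_unitary_normalizer[OF H comm assms(4)]
  note N = normalizer_imp_subgroup[OF subgroup.subset[OF H]]
  have "group_vna G K = group_vna G L \<longleftrightarrow> K = L" if "subgroup K G" "subgroup L G" for K L
    using group_vna_subset_iff[OF that] group_vna_subset_iff[OF that(2,1)] by auto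
  then have "group_vna G (normalizer G H) = group_vna G H \<longleftrightarrow> normalizer G H = H"
    "group_vna G (normalizer G H) = group_vna G (carrier G) \<longleftrightarrow> normalizer G H = carrier G"
    using N H subgroup_self by blast+
  then show ?thesis
    using masa bicomm normalizer_eq_carrier_iff[OF H]
    by (simp add: singular_masa_def cartan_masa_def)
qed

end
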